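(* Identify inchworm paths with their circle sequences $C=C_1C_2\cdots C_k$. Define a map $g$ recursively by $g(\varepsilon)=\varepsilon$ and $$g(C)=\begin{cases}F\,g(C') & \text{if } C=C_1C' \text{ is of form (a)},\\ U\,g(C')\,D\,g(C'') & \text{if } C=C_1C'C_jC''\text{ is of form (b)}.\end{cases}$$ Then $g$ is a bijection from the set of inchworm paths onto the set of peakless Motzkin paths (Motzkin paths avoiding the peak $UD$), under which inchworm paths with kissing number $k$ correspond to peakless Motzkin paths of length $k$.
   Context: Consider the hexagonal packing of the plane by circles of radius $2$ with centers $(2+4i+2j,\,2\sqrt3\,j)$, $i,j\in\mathbb Z$; the origin is the tangency point of two horizontally adjacent circles. The tangency points cut every circle into six arcs. Traversed from left to right these give six types of steps (angles measured on the circle carrying the arc): $U$ from $180^\circ$ to $120^\circ$ (displacement $(1,\sqrt3)$), $F$ from $120^\circ$ to $60^\circ$ (displacement $(2,0)$), $D$ from $60^\circ$ to $0^\circ$ (displacement $(1,-\sqrt3)$), $\overline U$ from $300^\circ$ to $360^\circ$ (displacement $(1,\sqrt3)$), $\overline F$ from $240^\circ$ to $300^\circ$ (displacement $(2,0)$), $\overline D$ from $180^\circ$ to $240^\circ$ (displacement $(1,-\sqrt3)$). A path in the packing starts at the origin, is a concatenation of such arcs of circles of the packing, each starting where the previous one ends, and stays in the quarter plane $x,y\ge 0$. Equivalently, it is a word in $\{U,F,D,\overline U,\overline F,\overline D\}$ whose first step (if any) is $U$, in which $U$ or $\overline F$ can only be followed by $F$ or $\overline U$; $F$ or $\overline D$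 only by $\overline F$ or $D$; $\overline U$ or $D$ only by $U$ or $\overline D$; and which never goes below ordinate $0$. A packing path is such a path ending on the $x$-axis (the empty path $\varepsilon$ included). Its kissing number is the number of circles of the packing lying below the path (under the path, with center of ordinate $\ge0$, between its starting and ending abscissas) that touch it, touching at a single point included. An inchworm path is a packing path in which neither $\overline U\,\overline D$ nor $DU$ occurs as two consecutive steps. Nonempty inchworm paths with kissing number $k$ correspond one-to-one (by listing from left to right the circles below the path that touch it) to sequences $C=C_1\cdots C_k$ of circles of the packing with centers of nonnegative ordinate such that $C_1$ is centered at $(2,0)$, $C_k$ is centered on the $x$-axis, and for every $i\ge2$ the circle $C_i$ is tangent to $C_{i-1}$ with center strictly to the right of that of $C_{i-1}$; the empty path corresponds to the empty sequence. Each nonempty such sequence has exactly one of two forms: (a) $C=C_1C'$ where $C'$ is a (possibly empty) sequence that is a horizontal translate of the sequence of an inchworm path; (b) $C=C_1C'C_jC''$ where $C'$ is the translate by the vector $(2,2\sqrt3)$ of the sequence of a nonempty inchworm path, $C_j$ is the first circle after $C_1$ centered on the $x$-axis, and $C''$ is a (possibly empty) horizontal translate of the sequence of an inchworm path. In the definition of $g$, translates are identified with the corresponding inchworm paths. On the image side, a Motzkin path is a word in the steps $U=(1,1)$, $D=(1,-1)$, $F=(1,0)$ starting at the origin, ending on and staying weakly above the $x$-axis; its length is its number of steps; it is peakless if $UD$ never occurs as two consecutive steps. *)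

theory Defs
  imports "HOL-Analysis.Analysis" "HOL-Library.Sublist"
begin

text \<open>The plane is the type of complex numbers. \<open>BarU\<close>, \<open>BarF\<close>, \<open>BarD\<close> are the
  overlined steps, which run along the lower half of a circle.\<close>

definition centers :: "complex set" where
  "centers = {Complex (2 + 4 * of_int i + 2 * of_int j) (2 * sqrt 3 * of_int j) | i j :: int. True}"

datatype step = ArcU | ArcF | ArcD | BarU | BarF | BarD

primrec start_angle :: "step \<Rightarrow> real" where
  "start_angle ArcU = pi"
| "start_angle ArcF = 2 * pi / 3"
| "start_angle ArcD = pi / 3"
| "start_angle BarU = 5 * pi / 3"
| "start_angle BarF = 4 * pi / 3"
| "start_angle BarD = pi"

primrec end_angle :: "step \<Rightarrow> real" where
  "end_angle ArcU = 2 * pi / 3"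
| "end_angle ArcF = pi / 3"
| "end_angle ArcD = 0"
| "end_angle BarU = 2 * pi"
| "end_angle BarF = 5 * pi / 3"
| "end_angle BarD = 4 * pi / 3"

text \<open>A step and its starting point \<open>z\<close> determine the circle of radius 2 that carries the arc.\<close>

definition arc_center :: "complex \<Rightarrow> step \<Rightarrow> complex" where
  "arc_center z s = z - 2 * cis (start_angle s)"

definition arc_points :: "complex \<Rightarrow> step \<Rightarrow> complex set" where
  "arc_points z s = (\<lambda>\<theta>. arc_center z s + 2 * cis \<theta>) ` closed_segment (start_angle s) (end_angle s)"

definition arc_end :: "complex \<Rightarrow> step \<Rightarrow> complex" where
  "arc_end z s = arc_center z s + 2 * cis (end_angle s)"

primrec path_points :: "complex \<Rightarrow> step list \<Rightarrow> complex set" where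
  "path_points z [] = {z}"
| "path_points z (s # w) = arc_points z s \<union> path_points (arc_end z s) w"

primrec path_end :: "complex \<Rightarrow> step list \<Rightarrow> complex" where
  "path_end z [] = z"
| "path_end z (s # w) = path_end (arc_end z s) w"

primrec on_packing :: "complex \<Rightarrow> step list \<Rightarrow> bool" where
  "on_packing z [] \<longleftrightarrow> True"
| "on_packing z (s # w) \<longleftrightarrow> arc_center z s \<in> centers \<and> on_packing (arc_end z s) w"

definition packing_paths :: "step list set" where
  "packing_paths = {w. on_packing 0 w \<and> (\<forall>p\<in>path_points 0 w. 0 \<le> Re p \<and> 0 \<le> Im p)
                      \<and> Im (path_end 0 w) = 0}"

definition inchworm_paths :: "step list set" where
  "inchworm_paths = {w \<in> packing_paths. \<not> sublist [BarU, BarD] w \<and> \<not> sublist [ArcD, ArcU] w}"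

text \<open>A circle lies under the path if above each of its points, on the same vertical line, there
  is a point of the path; this also forces the circle to lie between the starting and the ending
  abscissas of the path.\<close>

definition under_path :: "step list \<Rightarrow> complex \<Rightarrow> bool" where
  "under_path w c \<longleftrightarrow> (\<forall>z\<in>sphere c 2. \<exists>p\<in>path_points 0 w. Re p = Re z \<and> Im z \<le> Im p)"

definition kissed_circles :: "step list \<Rightarrow> complex set" where
  "kissed_circles w = {c \<in> centers. 0 \<le> Im c \<and> under_path w c \<and> sphere c 2 \<inter> path_points 0 w \<noteq> {}}"

definition kissing_number :: "step list \<Rightarrow> nat" where
  "kissing_number w = card (kissed_circles w)"

text \<open>Circles are represented by their centers.\<close>

definition circle_seq :: "step list \<Rightarrow> complex list" where
  "circle_seq w = (THE C. set C = kissed_circles w \<and> sorted_wrt (\<lambda>a b. Re a < Re b) C)"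

text \<open>Not every chain of tangent circles going to the right is the sequence of an inchworm path:
  the centers \<open>(2,0), (4,2\<surd>3), (6,0), (8,2\<surd>3), (10,0)\<close> are not, as no path lying above both
  raised circles touches the one in the valley between them. Hence the image of \<open>circle_seq\<close>.\<close>

definition inchworm_seqs :: "complex list set" where
  "inchworm_seqs = circle_seq ` inchworm_paths"

definition translate :: "complex \<Rightarrow> complex list \<Rightarrow> complex list" where
  "translate v C = map (\<lambda>c. c + v) C"

datatype mstep = MU | MF | MD

primrec mrise :: "mstep \<Rightarrow> int" where
  "mrise MU = 1"
| "mrise MF = 0"
| "mrise MD = - 1"

definition mheight :: "mstep list \<Rightarrow> int" where
  "mheight m = sum_list (map mrise m)"

definition motzkin_paths :: "mstep list set" where
  "motzkin_paths = {m. (\<forall>n\<le>length m. 0 \<le> mheight (take n m)) \<and> mheight m = 0}"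

definition peakless_motzkin_paths :: "mstep list set" where
  "peakless_motzkin_paths = {m \<in> motzkin_paths. \<not> sublist [MU, MD] m}"

text \<open>The graph of \<open>g\<close>. Translates are identified with inchworm sequences, so the recursive calls
  take the untranslated sequences \<open>A\<close> and \<open>B\<close>.\<close>

inductive g_graph :: "complex list \<Rightarrow> mstep list \<Rightarrow> bool" where
  empty: "g_graph [] []"
| form_a: "C \<in> inchworm_seqs \<Longrightarrow> C = c1 # translate (of_real t) A \<Longrightarrow> A \<in> inchworm_seqs \<Longrightarrow>
    g_graph A M \<Longrightarrow> g_graph C (MF # M)"
| form_b: "C \<in> inchworm_seqs \<Longrightarrow>
    C = c1 # translate (Complex 2 (2 * sqrt 3)) A @ cj # translate (of_real t) B \<Longrightarrow>
    A \<in> inchworm_seqs \<Longrightarrow> A \<noteq> [] \<Longrightarrow> B \<in> inchworm_seqs \<Longrightarrow>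
    (\<forall>c\<in>set (translate (Complex 2 (2 * sqrt 3)) A). Im c \<noteq> 0) \<Longrightarrow> Im cj = 0 \<Longrightarrow>
    g_graph A M \<Longrightarrow> g_graph B N \<Longrightarrow> g_graph C (MU # M @ MD # N)"

definition g :: "complex list \<Rightarrow> mstep list" where
  "g C = (THE M. g_graph C M)"

end

theory Submission
  imports Defs
begin

text \<open>A path is the graph of a continuous function that never enters the interior of a circle of
  the packing. By the intermediate value theorem, once it passes above the interior of a circle it
  stays above it, so the circles it kisses can be read off its steps. For an inchworm path they
  are obtained by translating the step groups \<open>BarU ArcU\<close>, \<open>ArcF\<close> and \<open>ArcD BarD\<close> into the
  Motzkin steps \<open>MU\<close>, \<open>MF\<close> and \<open>MD\<close>, with one circle per Motzkin step. This translation is a bijection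
  onto the peakless Motzkin paths, and the recursion for \<open>g\<close> follows the first-return decomposition
  of the resulting Motzkin path, so \<open>g\<close> inverts the passage from Motzkin words to circle sequences.\<close>

section \<open>The geometry of packing paths\<close>

text \<open>Centers and tangency points all have the form \<open>lattice_pt x y\<close>, so once
  distances are settled, statements about paths become statements about residues mod 4 and heights.
  The exclusion of peaks has a geometric source. In a factor \<open>MU MD\<close> both letters would
  stand for the same circle. On the path side a climb ends at the 120 degree point of a circle and a
  descent starts at the 60 degree point, so an \<open>ArcF\<close> has to come in between. Two
  obstacles shape the combinatorial half. First, \<open>MU\<close> and \<open>MF\<close> record the
  same circle; only the next circle, or the total height if there is none, tells them apart. Second,
  \<open>g_graph\<close> does not prescribe the offset \<open>t\<close> or the abscissa of
  \<open>cj\<close>, so its result has to be shown independent of how a sequence is cut. This works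
  because every nonempty inchworm sequence starts at (2,0), because forms (a) and (b) differ in the
  ordinate of the second circle, and because form (b) is cut at the first later circle on the
  axis.\<close>

definition lattice_pt :: "int \<Rightarrow> int \<Rightarrow> complex" where
  "lattice_pt x y = Complex (of_int x) (sqrt 3 * of_int y)"

lemma Re_lattice_pt [simp]: "Re (lattice_pt x y) = of_int x"
  and Im_lattice_pt [simp]: "Im (lattice_pt x y) = sqrt 3 * of_int y"
  by (simp_all add: lattice_pt_def)

lemma lattice_pt_eq_iff [simp]: "lattice_pt x y = lattice_pt x' y' \<longleftrightarrow> x = x' \<and> y = y'"
  by (auto simp: complex_eq_iff)

lemma lattice_pt_add: "lattice_pt x y + lattice_pt x' y' = lattice_pt (x + x') (y + y')"
  by (simp add: complex_eq_iff algebra_simps)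

lemma lattice_pt_0_0: "0 = lattice_pt 0 0"
  by (simp add: complex_eq_iff)

text \<open>With \<open>y = 2 * j\<close> the parametrization gives
  \<open>x - y = 2 + 4 * i\<close>. The congruence replaces the search for \<open>i\<close> and
  \<open>j\<close>, so later membership goals fall to linear arithmetic.\<close>

lemma lattice_pt_in_centers [simp]:
  "lattice_pt x y \<in> centers \<longleftrightarrow> even y \<and> (x - y) mod 4 = 2"
proof
  assume "lattice_pt x y \<in> centers"
  then obtain i j :: int where
    "lattice_pt x y = Complex (2 + 4 * of_int i + 2 * of_int j) (2 * sqrt 3 * of_int j)"
    unfolding centers_def by blast
  then have "lattice_pt x y = lattice_pt (2 + 4 * i + 2 * j) (2 * j)"
    by (simp add: lattice_pt_def)
  then have "x = 2 + 4 * i + 2 * j" "y = 2 * j" by simp_all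
  then show "even y \<and> (x - y) mod 4 = 2" by simp
next
  assume a: "even y \<and> (x - y) mod 4 = 2"
  then obtain j where j: "y = 2 * j" by blast
  define i where "i = (x - y) div 4"
  have "x = 2 + 4 * i + 2 * j" using a j unfolding i_def by presburger
  then show "lattice_pt x y \<in> centers"
    unfolding centers_def lattice_pt_def using j by auto
qed

lemma centersE:
  assumes "c \<in> centers"
  obtains x y where "c = lattice_pt x y" "even y" "(x - y) mod 4 = 2"
proof -
  obtain i j :: int where
    "c = Complex (2 + 4 * of_int i + 2 * of_int j) (2 * sqrt 3 * of_int j)"
    using assms unfolding centers_def by blast
  then have "c = lattice_pt (2 + 4 * i + 2 * j) (2 * j)"
    by (simp add: lattice_pt_def)
  with that assms show ?thesis by (metis lattice_pt_in_centers)
qed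

section \<open>Arcs and paths as graphs over the real axis\<close>

primrec center_dx :: "step \<Rightarrow> int" where
  "center_dx ArcU = 2" | "center_dx ArcF = 1" | "center_dx ArcD = - 1"
| "center_dx BarU = - 1" | "center_dx BarF = 1" | "center_dx BarD = 2"

primrec center_dy :: "step \<Rightarrow> int" where
  "center_dy ArcU = 0" | "center_dy ArcF = - 1" | "center_dy ArcD = - 1"
| "center_dy BarU = 1" | "center_dy BarF = 1" | "center_dy BarD = 0"

primrec step_dx :: "step \<Rightarrow> int" where
  "step_dx ArcU = 1" | "step_dx ArcF = 2" | "step_dx ArcD = 1"
| "step_dx BarU = 1" | "step_dx BarF = 2" | "step_dx BarD = 1"

primrec step_dy :: "step \<Rightarrow> int" where
  "step_dy ArcU = 1" | "step_dy ArcF = 0" | "step_dy ArcD = - 1"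
| "step_dy BarU = 1" | "step_dy BarF = 0" | "step_dy BarD = - 1"

primrec upper_arc :: "step \<Rightarrow> bool" where
  "upper_arc ArcU = True" | "upper_arc ArcF = True" | "upper_arc ArcD = True"
| "upper_arc BarU = False" | "upper_arc BarF = False" | "upper_arc BarD = False"

lemma cos_sin_sixths:
  "cos (2 * pi / 3) = - 1 / 2" "sin (2 * pi / 3) = sqrt 3 / 2"
  "cos (4 * pi / 3) = - 1 / 2" "sin (4 * pi / 3) = - sqrt 3 / 2"
  "cos (5 * pi / 3) = 1 / 2" "sin (5 * pi / 3) = - sqrt 3 / 2"
proof -
  have e: "2 * pi / 3 = pi - pi / 3" "4 * pi / 3 = pi / 3 + pi" "5 * pi / 3 = 2 * pi - pi / 3"
    by simp_all
  show "cos (2 * pi / 3) = - 1 / 2" "sin (2 * pi / 3) = sqrt 3 / 2"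
    unfolding e(1) by (simp_all only: cos_pi_minus sin_pi_minus cos_60 sin_60)
  show "cos (4 * pi / 3) = - 1 / 2" "sin (4 * pi / 3) = - sqrt 3 / 2"
    unfolding e(2) by (simp_all only: cos_periodic_pi sin_periodic_pi cos_60 sin_60)
  show "cos (5 * pi / 3) = 1 / 2" "sin (5 * pi / 3) = - sqrt 3 / 2"
    unfolding e(3) by (simp_all only: cos_2pi_minus sin_2pi_minus cos_60 sin_60)
qed

lemma arc_center_lattice_pt [simp]:
  "arc_center (lattice_pt x y) s = lattice_pt (x + center_dx s) (y + center_dy s)"
  by (cases s) (simp_all add: arc_center_def complex_eq_iff cos_sin_sixths cos_60 sin_60, simp_all add: algebra_simps)

lemma arc_end_lattice_pt [simp]:
  "arc_end (lattice_pt x y) s = lattice_pt (x + step_dx s) (y + step_dy s)"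
  by (cases s) (simp_all add: arc_end_def complex_eq_iff cos_sin_sixths cos_60 sin_60, simp_all add: algebra_simps)

definition arc_height :: "complex \<Rightarrow> step \<Rightarrow> real \<Rightarrow> real" where
  "arc_height z s x = (let c = arc_center z s; h = sqrt (4 - (x - Re c)\<^sup>2)
    in if upper_arc s then Im c + h else Im c - h)"

text \<open>Real \<open>sqrt\<close> is total and continuous on the whole line, which covers
  negative radicands too.\<close>

lemma continuous_on_arc_height: "continuous_on A (arc_height z s)"
  unfolding arc_height_def Let_def by (cases "upper_arc s") (auto intro!: continuous_intros)

lemma cos_image_upper:
  assumes "0 \<le> a" "a \<le> b" "b \<le> pi"
  shows "cos ` {a..b} = {cos b..cos a}"
proof
  show "cos ` {a..b} \<subseteq> {cos b..cos a}" using assms by (auto intro!: cos_monotone_0_pi_le)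
  show "{cos b..cos a} \<subseteq> cos ` {a..b}"
  proof
    fix u assume "u \<in> {cos b..cos a}"
    then have "\<exists>x\<ge>a. x \<le> b \<and> cos x = u"
      using IVT2[of cos b u a] assms by auto
    then show "u \<in> cos ` {a..b}" by auto
  qed
qed

text \<open>An arc stays in the closed upper or lower half of its circle, where \<open>sin\<close>
  has constant sign, so its height is a function of the abscissa.\<close>

lemma arc_points_eq_graph:
  "arc_points z s = (\<lambda>x. Complex x (arc_height z s x)) ` {Re z..Re (arc_end z s)}"
proof -
  define c where "c = arc_center z s"
  have z: "z = c + 2 * cis (start_angle s)"
    by (simp add: c_def arc_center_def)
  have e: "arc_end z s = c + 2 * cis (end_angle s)"
    by (simp add: c_def arc_end_def)
  have sq: "sqrt (4 - 4 * (cos t)\<^sup>2) = 2 * \<bar>sin t\<bar>" for t :: real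
  proof -
    have "4 - 4 * (cos t)\<^sup>2 = (2 * sin t)\<^sup>2"
      by (simp add: power_mult_distrib cos_squared_eq)
    then show ?thesis by (simp only: real_sqrt_abs abs_mult abs_numeral)
  qed
  show ?thesis
  proof (cases "upper_arc s")
    case True
    define a b where "a = end_angle s" and "b = start_angle s"
    have ab: "0 \<le> a" "a \<le> b" "b \<le> pi"
      using True by (cases s; simp add: a_def b_def)+
    have "arc_points z s = (\<lambda>t. c + 2 * cis t) ` {a..b}"
      using ab by (simp add: arc_points_def c_def a_def b_def closed_segment_eq_real_ivl)
    also have "\<dots> = (\<lambda>t. Complex (Re c + 2 * cos t) (arc_height z s (Re c + 2 * cos t))) ` {a..b}"
    proof (rule image_cong[OF refl])
      fix t assume "t \<in> {a..b}"
      then have "sin t \<ge> 0" using ab by (auto intro: sin_ge_zero)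
      then show "c + 2 * cis t = Complex (Re c + 2 * cos t) (arc_height z s (Re c + 2 * cos t))"
        using True by (simp add: arc_height_def Let_def sq complex_eq_iff flip: c_def)
    qed
    also have "\<dots> = (\<lambda>x. Complex x (arc_height z s x)) ` (\<lambda>u. Re c + 2 * u) ` cos ` {a..b}"
      by (simp add: image_image)
    also have "(\<lambda>u. Re c + 2 * u) ` cos ` {a..b} = {Re z..Re (arc_end z s)}"
      unfolding cos_image_upper[OF ab] using ab cos_monotone_0_pi_le[OF ab]
      by (subst z, subst e) (simp add: a_def b_def add.commute[of "Re c"] image_affinity_atLeastAtMost)
    finally show ?thesis .
  next
    case False
    \<comment> \<open>The reflection of \<open>t\<close> to \<open>2 * pi - t\<close> brings the
      lower half into \<open>[0, pi]\<close>; it preserves \<open>cos\<close> and negates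
      \<open>sin\<close>, so \<open>cos_image_upper\<close> applies again.\<close>
    define a b where "a = 2 * pi - end_angle s" and "b = 2 * pi - start_angle s"
    have ab: "0 \<le> a" "a \<le> b" "b \<le> pi"
      using False by (cases s; simp add: a_def b_def)+
    have "arc_points z s = (\<lambda>t. c + 2 * cis t) ` {2 * pi - b..2 * pi - a}"
      using ab by (simp add: arc_points_def c_def a_def b_def closed_segment_eq_real_ivl)
    also have "{2 * pi - b..2 * pi - a} = (\<lambda>t. 2 * pi - t) ` {a..b}"
      by simp
    also have "(\<lambda>t. c + 2 * cis t) ` \<dots> = (\<lambda>t. c + 2 * cis (2 * pi - t)) ` {a..b}"
      by (simp only: image_image)
    also have "\<dots> = (\<lambda>t. Complex (Re c + 2 * cos t) (arc_height z s (Re c + 2 * cos t))) ` {a..b}"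
    proof (rule image_cong[OF refl])
      fix t assume "t \<in> {a..b}"
      then have "sin t \<ge> 0" using ab by (auto intro: sin_ge_zero)
      then show "c + 2 * cis (2 * pi - t)
          = Complex (Re c + 2 * cos t) (arc_height z s (Re c + 2 * cos t))"
        using False
        by (simp add: arc_height_def Let_def sq complex_eq_iff flip: c_def)
    qed
    also have "\<dots> = (\<lambda>x. Complex x (arc_height z s x)) ` (\<lambda>u. Re c + 2 * u) ` cos ` {a..b}"
      by (simp add: image_image)
    also have "(\<lambda>u. Re c + 2 * u) ` cos ` {a..b} = {Re z..Re (arc_end z s)}"
      unfolding cos_image_upper[OF ab] using ab cos_monotone_0_pi_le[OF ab]
      by (subst z, subst e) (simp add: a_def b_def add.commute[of "Re c"] image_affinity_atLeastAtMost)
    finally show ?thesis .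
  qed
qed

lemma step_dx_pos: "0 < step_dx s"
  by (cases s) simp_all

lemma path_end_lattice_pt:
  "\<exists>x' y'. path_end (lattice_pt x y) w = lattice_pt x' y' \<and> x \<le> x'"
proof (induction w arbitrary: x y)
  case (Cons s w)
  obtain x' y' where "path_end (lattice_pt (x + step_dx s) (y + step_dy s)) w = lattice_pt x' y'"
    "x + step_dx s \<le> x'"
    using Cons.IH by blast
  then show ?case using step_dx_pos[of s]
    by simp
qed auto

lemma arc_height_start_end:
  "Complex (Re z) (arc_height z s (Re z)) = z"
  "Complex (Re (arc_end z s)) (arc_height z s (Re (arc_end z s))) = arc_end z s"
proof -
  have "z \<in> arc_points z s"
    unfolding arc_points_def by (rule image_eqI[of _ _ "start_angle s"]) (simp_all add: arc_center_def)
  then show "Complex (Re z) (arc_height z s (Re z)) = z"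
    unfolding arc_points_eq_graph by (auto simp: complex_eq_iff)
  have "arc_end z s \<in> arc_points z s"
    unfolding arc_points_def by (rule image_eqI[of _ _ "end_angle s"]) (simp_all add: arc_end_def)
  then show "Complex (Re (arc_end z s)) (arc_height z s (Re (arc_end z s))) = arc_end z s"
    unfolding arc_points_eq_graph by (auto simp: complex_eq_iff)
qed

lemma start_in_path_points: "z \<in> path_points z w"
proof (cases w)
  case (Cons s v)
  have "z \<in> arc_points z s"
    unfolding arc_points_def by (rule image_eqI[of _ _ "start_angle s"]) (simp_all add: arc_center_def)
  with Cons show ?thesis by simp
qed simp

lemma arc_end_in_arc_points: "arc_end z s \<in> arc_points z s"
  unfolding arc_points_def by (rule image_eqI[of _ _ "end_angle s"]) (simp_all add: arc_end_def)

text \<open>Arcs are glued one by one. At each joint both pieces pass through the common tangency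
  point, which makes the case distinction continuous.\<close>

lemma path_points_graph:
  "\<exists>f. continuous_on {x..Re (path_end (lattice_pt x y) w)} f
     \<and> path_points (lattice_pt x y) w = (\<lambda>u. Complex u (f u)) ` {x..Re (path_end (lattice_pt x y) w)}"
proof (induction w arbitrary: x y)
  case Nil
  show ?case
    by (intro exI[of _ "\<lambda>_. sqrt 3 * of_int y"]) (simp add: complex_eq_iff)
next
  case (Cons s w)
  define z where "z = lattice_pt x y"
  define x1 where "x1 = x + step_dx s"
  define y1 where "y1 = y + step_dy s"
  define b where "b = Re (path_end (lattice_pt x1 y1) w)"
  have x1: "x \<le> x1" using step_dx_pos[of s] by (simp add: x1_def)
  have e: "arc_end z s = lattice_pt x1 y1" by (simp add: z_def x1_def y1_def)
  have b: "x1 \<le> b"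
    using path_end_lattice_pt[of x1 y1 w] by (auto simp: b_def)
  obtain f where f: "continuous_on {x1..b} f"
    "path_points (lattice_pt x1 y1) w = (\<lambda>u. Complex u (f u)) ` {x1..b}"
    using Cons.IH[of x1 y1] unfolding b_def by blast
  have "arc_end z s \<in> path_points (arc_end z s) w"
    by (rule start_in_path_points)
  then have fx1: "f x1 = sqrt 3 * y1"
    by (auto simp: e f(2) complex_eq_iff)
  have hx1: "arc_height z s x1 = sqrt 3 * y1"
    using arc_height_start_end(2)[of z s] by (simp add: e complex_eq_iff)
  define h where "h = (\<lambda>u. if u \<le> real_of_int x1 then arc_height z s u else f u)"
  have "continuous_on ({x..x1} \<union> {x1..b}) h"
    unfolding h_def
    by (intro continuous_on_If continuous_on_arc_height f(1)) (auto simp: fx1 hx1)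
  also have "{real_of_int x..x1} \<union> {x1..b} = {x..b}" using x1 b by auto
  finally have "continuous_on {x..b} h" .
  moreover have "path_points z (s # w) = (\<lambda>u. Complex u (h u)) ` {x..b}"
  proof -
    have "path_points z (s # w)
        = (\<lambda>u. Complex u (arc_height z s u)) ` {real_of_int x..x1} \<union> (\<lambda>u. Complex u (f u)) ` {x1..b}"
      by (simp add: arc_points_eq_graph e f(2)) (simp add: z_def)
    also have "\<dots> = (\<lambda>u. Complex u (h u)) ` {real_of_int x..x1} \<union> (\<lambda>u. Complex u (h u)) ` {x1..b}"
      by (intro arg_cong2[of _ _ _ _ "(\<union>)"] image_cong refl) (auto simp: h_def fx1 hx1)
    also have "\<dots> = (\<lambda>u. Complex u (h u)) ` {x..b}"
      unfolding image_Un[symmetric] \<open>{real_of_int x..x1} \<union> {x1..b} = {x..b}\<close> ..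
    finally show ?thesis .
  qed
  moreover have "Re (path_end (lattice_pt x y) (s # w)) = b"
    by (simp add: b_def x1_def y1_def)
  ultimately show ?case by (auto simp: z_def)
qed

lemma path_end_in_path_points: "path_end z w \<in> path_points z w"
  by (induction w arbitrary: z) auto

section \<open>Distances from centers to paths\<close>

lemma dist_arc_center: "p \<in> arc_points z s \<Longrightarrow> dist (arc_center z s) p = 2"
  by (auto simp: arc_points_def dist_norm norm_mult)

lemma dist_complex_sq: "(dist c p)\<^sup>2 = (Re c - Re p)\<^sup>2 + (Im c - Im p)\<^sup>2" for c p :: complex
  by (simp add: dist_norm cmod_power2)

lemma dist_lattice_pt_sq:
  "(dist (lattice_pt x y) (lattice_pt x' y'))\<^sup>2 = of_int ((x - x')\<^sup>2 + 3 * (y - y')\<^sup>2)"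
  by (simp add: dist_complex_sq power_mult_distrib flip: right_diff_distrib)

lemma int_sq_ge: "k\<^sup>2 \<le> a\<^sup>2" if "0 \<le> k" "k \<le> \<bar>a\<bar>" for a k :: int
  using that by (metis abs_of_nonneg power2_abs power_mono)

text \<open>Here \<open>(u, v)\<close> is the difference of two centers and the quadratic form its
  squared length: 16 belongs to tangent circles, and the six nonzero pairs are the neighbors of a
  circle. Outside a small box the form exceeds 16; the rest is a finite check.\<close>

lemma center_difference:
  fixes u v :: int
  assumes "even v" "(u - v) mod 4 = 0"
  shows "u = 0 \<and> v = 0 \<or> 16 \<le> u\<^sup>2 + 3 * v\<^sup>2"
    and "u\<^sup>2 + 3 * v\<^sup>2 \<le> 16 \<Longrightarrow> (u, v) \<in> {(0, 0), (4, 0), (- 4, 0), (2, 2), (2, - 2), (- 2, 2), (- 2, - 2)}"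
proof -
  have "16 < u\<^sup>2 + 3 * v\<^sup>2 \<or> (u, v) \<in> {(0, 0), (4, 0), (- 4, 0), (2, 2), (2, - 2), (- 2, 2), (- 2, - 2)}"
  proof (cases "\<bar>v\<bar> \<ge> 3 \<or> \<bar>u\<bar> \<ge> 5")
    case True
    have "0 \<le> u\<^sup>2" "0 \<le> v\<^sup>2" by simp_all
    moreover have "9 \<le> v\<^sup>2 \<or> 25 \<le> u\<^sup>2"
      using True int_sq_ge[of 3 v] int_sq_ge[of 5 u] by auto
    ultimately have "16 < u\<^sup>2 + 3 * v\<^sup>2" by linarith
    then show ?thesis ..
  next
    case False
    then have "v \<in> {-2, -1, 0, 1, 2}" "u \<in> {-4, -3, -2, -1, 0, 1, 2, 3, 4}" by auto
    then show ?thesis using assms by (elim insertE emptyE) simp_all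
  qed
  then show "u = 0 \<and> v = 0 \<or> 16 \<le> u\<^sup>2 + 3 * v\<^sup>2"
    "u\<^sup>2 + 3 * v\<^sup>2 \<le> 16 \<Longrightarrow> (u, v) \<in> {(0, 0), (4, 0), (- 4, 0), (2, 2), (2, - 2), (- 2, 2), (- 2, - 2)}"
    by auto
qed

lemma dist_centers_ge:
  assumes "c \<in> centers" "c' \<in> centers" "c \<noteq> c'"
  shows "4 \<le> dist c c'"
proof -
  obtain a b where c: "c = lattice_pt a b" "even b" "(a - b) mod 4 = 2"
    using assms(1) by (rule centersE)
  obtain a' b' where c': "c' = lattice_pt a' b'" "even b'" "(a' - b') mod 4 = 2"
    using assms(2) by (rule centersE)
  have "even (b - b')" using c c' by simp
  moreover have "((a - a') - (b - b')) mod 4 = 0" using c c' by presburger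
  ultimately have "16 \<le> (a - a')\<^sup>2 + 3 * (b - b')\<^sup>2"
    using center_difference(1)[of "b - b'" "a - a'"] assms(3) c(1) c'(1) by auto
  then have "real_of_int 16 \<le> of_int ((a - a')\<^sup>2 + 3 * (b - b')\<^sup>2)"
    by (simp only: of_int_le_iff)
  then have "4\<^sup>2 \<le> (dist c c')\<^sup>2"
    unfolding c(1) c'(1) dist_lattice_pt_sq by simp
  then show ?thesis by (rule power2_le_imp_le) simp
qed

text \<open>A point of an arc has distance 2 from the center of that arc and, by the triangle
  inequality, at least 4 - 2 from every other center. The assumption on \<open>z\<close> settles the
  empty path and is renewed at each tangency point.\<close>

lemma dist_center_path_point:
  assumes "on_packing z w" "\<forall>c\<in>centers. 2 \<le> dist c z" "p \<in> path_points z w" "c \<in> centers"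
  shows "2 \<le> dist c p"
  using assms(1-3)
proof (induction w arbitrary: z)
  case (Cons s w)
  have arc: "2 \<le> dist c' q" if "q \<in> arc_points z s" "c' \<in> centers" for c' q
  proof (cases "c' = arc_center z s")
    case False
    then have "4 \<le> dist c' (arc_center z s)" using Cons.prems that by (intro dist_centers_ge) auto
    then show ?thesis
      using dist_arc_center[OF that(1)] dist_triangle[of c' "arc_center z s" q]
      by (simp add: dist_commute)
  qed (simp add: dist_arc_center[OF that(1)])
  show ?case
  proof (cases "p \<in> arc_points z s")
    case False
    then show ?thesis
      using Cons.prems arc[OF arc_end_in_arc_points] by (intro Cons.IH[of "arc_end z s"]) auto
  qed (use arc assms(4) in auto)
qed (use assms(4) in auto)

lemma dist_center_path_point_0:
  assumes "on_packing 0 w" "p \<in> path_points 0 w" "c \<in> centers"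
  shows "2 \<le> dist c p"
proof (rule dist_center_path_point[OF assms(1) _ assms(2,3)], rule ballI)
  fix c assume "c \<in> centers"
  then obtain a b where c: "c = lattice_pt a b" "even b" "(a - b) mod 4 = 2"
    by (rule centersE)
  have "4 \<le> a\<^sup>2 + 3 * b\<^sup>2"
  proof (cases "b = 0")
    case True
    with c have "2 \<le> \<bar>a\<bar>" by presburger
    then show ?thesis using int_sq_ge[of 2 a] True by simp
  next
    case False
    with c have "2 \<le> \<bar>b\<bar>" by presburger
    then have "4 \<le> b\<^sup>2" using int_sq_ge[of 2 b] by simp
    moreover have "0 \<le> a\<^sup>2" by simp
    ultimately show ?thesis by linarith
  qed
  then have "real_of_int 4 \<le> of_int (a\<^sup>2 + 3 * b\<^sup>2)"
    by (simp only: of_int_le_iff)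
  then have "2\<^sup>2 \<le> (dist c 0)\<^sup>2"
    unfolding c(1) lattice_pt_0_0 dist_lattice_pt_sq by simp
  then show "2 \<le> dist c 0" by (rule power2_le_imp_le) simp
qed

section \<open>Circles lying under a path\<close>

lemma path_points_0_graph:
  obtains f where "continuous_on {0..Re (path_end 0 w)} f"
    "path_points 0 w = (\<lambda>u. Complex u (f u)) ` {0..Re (path_end 0 w)}"
  using path_points_graph[of 0 0 w] by (auto simp flip: lattice_pt_0_0)

text \<open>Otherwise the path would cross the level \<open>Im c\<close> over the diameter of the
  circle, and every inner point of the diameter is closer than 2 to the center.\<close>

lemma path_stays_above:
  assumes w: "on_packing 0 w" and c: "c \<in> centers"
    and q: "q \<in> path_points 0 w" "\<bar>Re q - Re c\<bar> < 2" "Im c < Im q"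
    and p: "p \<in> path_points 0 w" "\<bar>Re p - Re c\<bar> \<le> 2"
  shows "Im c \<le> Im p"
proof (rule ccontr)
  assume neg: "\<not> Im c \<le> Im p"
  obtain f where f: "continuous_on {0..Re (path_end 0 w)} f"
    "path_points 0 w = (\<lambda>u. Complex u (f u)) ` {0..Re (path_end 0 w)}"
    by (rule path_points_0_graph)
  obtain a where a: "p = Complex a (f a)" "a \<in> {0..Re (path_end 0 w)}" using p(1) f(2) by auto
  obtain b where b: "q = Complex b (f b)" "b \<in> {0..Re (path_end 0 w)}" using q(1) f(2) by auto
  have sub: "closed_segment a b \<subseteq> {0..Re (path_end 0 w)}"
    using a b by (auto simp: closed_segment_eq_real_ivl split: if_splits)
  have "connected (f ` closed_segment a b)"
    by (intro connected_continuous_image continuous_on_subset[OF f(1) sub] connected_segment)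
  then have "{f a..f b} \<subseteq> f ` closed_segment a b"
    by (rule connected_contains_Icc) auto
  moreover have "Im c \<in> {f a..f b}" using neg q(3) a b by simp
  ultimately obtain u where u: "u \<in> closed_segment a b" "f u = Im c" by (metis imageE subsetD)
  have "Complex u (Im c) \<in> path_points 0 w" using u sub by (auto simp: f(2))
  then have "2 \<le> dist c (Complex u (Im c))" using w c by (intro dist_center_path_point_0)
  then have "2 \<le> \<bar>Re c - u\<bar>" by (simp add: dist_norm cmod_def)
  \<comment> \<open>The crossing can only happen on the border of the strip, and of the segment from
    \<open>a\<close> to \<open>b\<close> only \<open>a\<close> can lie there.\<close>
  then have "u = a"
    using u(1) q(2) p(2) a(1) b(1) by (auto simp: closed_segment_eq_real_ivl split: if_splits)
  then show False using neg a u by simp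
qed

text \<open>A path point on the axis cannot lie in the open strip over the circle, so both ends of
  the path are beyond the diameter and the path passes over all of it. There it is at or above the
  level of the center and at distance at least 2, hence on or above the upper semicircle.\<close>

lemma under_pathI:
  assumes w: "on_packing 0 w" "Im (path_end 0 w) = 0" and c: "c \<in> centers" "0 \<le> Im c"
    and q: "q \<in> path_points 0 w" "\<bar>Re q - Re c\<bar> < 2" "Im c < Im q"
  shows "under_path w c"
proof -
  define e where "e = path_end 0 w"
  obtain f where f: "continuous_on {0..Re e} f"
    "path_points 0 w = (\<lambda>u. Complex u (f u)) ` {0..Re e}"
    using path_points_0_graph unfolding e_def by blast
  have far: "2 \<le> \<bar>Re r - Re c\<bar>" if r: "r \<in> path_points 0 w" "Im r = 0" for r
  proof (rule ccontr)
    assume near: "\<not> 2 \<le> \<bar>Re r - Re c\<bar>"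
    then have "Im c \<le> Im r" by (intro path_stays_above[OF w(1) c(1) q r(1)]) simp
    with c r have "Im c = Im r" by simp
    then have "dist c r = \<bar>Re r - Re c\<bar>" by (simp add: dist_norm cmod_def)
    moreover have "2 \<le> dist c r" using w c r by (intro dist_center_path_point_0)
    ultimately show False using near by simp
  qed
  have rq: "0 \<le> Re q" "Re q \<le> Re e" using q(1) f(2) by auto
  have "2 \<le> Re c" using far[of 0] start_in_path_points[of 0 w] rq q(2) by simp
  moreover have "Re c + 2 \<le> Re e"
    using far[of e] path_end_in_path_points[of 0 w] w(2) rq q(2) by (simp add: e_def)
  moreover have "\<exists>p\<in>path_points 0 w. Re p = Re z \<and> Im z \<le> Im p"
    if z: "z \<in> sphere c 2" and bounds: "2 \<le> Re c" "Re c + 2 \<le> Re e" for z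
  proof -
    have dz: "dist c z = 2" using z by simp
    have "\<bar>Re (c - z)\<bar> \<le> 2" using abs_Re_le_cmod[of "c - z"] dz by (simp add: dist_norm)
    then have rz: "\<bar>Re z - Re c\<bar> \<le> 2" by simp
    define p where "p = Complex (Re z) (f (Re z))"
    have p: "p \<in> path_points 0 w" using rz bounds unfolding f(2) p_def
      by (intro image_eqI[OF refl]) auto
    have "2 \<le> dist c p" using w c p by (intro dist_center_path_point_0)
    then have "(dist c z)\<^sup>2 \<le> (dist c p)\<^sup>2" using dz by (intro power_mono) auto
    then have "(Im c - Im z)\<^sup>2 \<le> (Im p - Im c)\<^sup>2"
      by (simp add: dist_complex_sq p_def power2_commute)
    moreover have "Im c \<le> Im p"
      using rz by (intro path_stays_above[OF w(1) c(1) q p]) (simp add: p_def)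
    ultimately have "\<bar>Im c - Im z\<bar> \<le> Im p - Im c"
      using abs_le_square_iff[of "Im c - Im z" "Im p - Im c"] by simp
    then have "Re p = Re z \<and> Im z \<le> Im p" by (simp add: p_def)
    with p show ?thesis by blast
  qed
  ultimately show ?thesis unfolding under_path_def by blast
qed

text \<open>For the last claim reflect \<open>p\<close> in the horizontal diameter. The mirror image
  is on the circle, and \<open>p\<close> is the only path point on that vertical line, so
  \<open>p\<close> is not below its mirror image.\<close>

lemma under_pathD:
  assumes "under_path w c"
  shows "2 \<le> Re c" "Re c + 2 \<le> Re (path_end 0 w)"
    and "\<And>p. p \<in> path_points 0 w \<Longrightarrow> dist c p = 2 \<Longrightarrow> Im c \<le> Im p"
proof -
  obtain f where f: "path_points 0 w = (\<lambda>u. Complex u (f u)) ` {0..Re (path_end 0 w)}"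
    using path_points_0_graph by blast
  have u: "\<exists>p\<in>path_points 0 w. Re p = Re z \<and> Im z \<le> Im p" if "dist c z = 2" for z
    using assms that by (simp add: under_path_def)
  show "2 \<le> Re c" using u[of "c - 2"] by (auto simp: dist_norm f)
  show "Re c + 2 \<le> Re (path_end 0 w)" using u[of "c + 2"] by (auto simp: dist_norm f)
  fix p assume p: "p \<in> path_points 0 w" "dist c p = 2"
  have "dist c (Complex (Re p) (2 * Im c - Im p)) = dist c p"
    by (simp add: dist_norm cmod_def power2_commute)
  then obtain p' where "p' \<in> path_points 0 w" "Re p' = Re p" "2 * Im c - Im p \<le> Im p'"
    using u[of "Complex (Re p) (2 * Im c - Im p)"] p(2) by auto
  moreover have "p' = p" using calculation p(1) by (auto simp: f)
  ultimately show "Im c \<le> Im p" by simp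
qed

text \<open>The circles touched from above by a step starting at \<open>z\<close>, at an inner point or at an
  endpoint of the arc that lies in the open upper half of the circle.\<close>

primrec beneath_step :: "complex \<Rightarrow> step \<Rightarrow> complex set" where
  "beneath_step z ArcU = {z + lattice_pt 2 0}"
| "beneath_step z ArcF = {z + lattice_pt 1 (- 1)}"
| "beneath_step z ArcD = {z + lattice_pt (- 1) (- 1)}"
| "beneath_step z BarU = {z + lattice_pt 1 (- 1)}"
| "beneath_step z BarF = {z + lattice_pt (- 1) (- 1), z + lattice_pt 3 (- 1)}"
| "beneath_step z BarD = {z + lattice_pt 0 (- 2)}"

primrec beneath :: "complex \<Rightarrow> step list \<Rightarrow> complex set" where
  "beneath z [] = {}"
| "beneath z (s # w) = beneath_step z s \<union> beneath (arc_end z s) w"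

text \<open>The witness is the 60 or 120 degree point of the circle: strictly above the center and
  strictly inside the strip, as \<open>under_pathI\<close> demands.\<close>

lemma beneath_step_touch:
  assumes "c \<in> beneath_step (lattice_pt x y) s" "arc_center (lattice_pt x y) s \<in> centers"
  shows "\<exists>a b i. c = lattice_pt a b \<and> c \<in> centers \<and> \<bar>i\<bar> = 1
    \<and> lattice_pt (a + i) (b + 1) \<in> arc_points (lattice_pt x y) s"
proof -
  have z: "lattice_pt x y \<in> arc_points (lattice_pt x y) s"
    using start_in_path_points[of "lattice_pt x y" "[s]"] arc_end_in_arc_points[of "lattice_pt x y" s]
    by auto
  have e: "lattice_pt (x + step_dx s) (y + step_dy s) \<in> arc_points (lattice_pt x y) s"
    using arc_end_in_arc_points[of "lattice_pt x y" s] by simp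
  show ?thesis
  proof (cases s)
    case ArcU
    then show ?thesis using assms e
      by - (rule exI[of _ "x + 2"], rule exI[of _ y], rule exI[of _ "- 1"], simp add: lattice_pt_add add.commute)
  next
    case ArcF
    then show ?thesis using assms z
      by - (rule exI[of _ "x + 1"], rule exI[of _ "y - 1"], rule exI[of _ "- 1"], simp add: lattice_pt_add)
  next
    case ArcD
    then show ?thesis using assms z
      by - (rule exI[of _ "x - 1"], rule exI[of _ "y - 1"], rule exI[of _ 1], simp add: lattice_pt_add)
  next
    case BarU
    have "even (y - 1) \<and> (x + 1 - (y - 1)) mod 4 = 2" using assms BarU by simp presburger
    then show ?thesis using assms z BarU
      by - (rule exI[of _ "x + 1"], rule exI[of _ "y - 1"], rule exI[of _ "- 1"], simp add: lattice_pt_add)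
  next
    case BarF
    have 1: "even (y - 1) \<and> (x - 1 - (y - 1)) mod 4 = 2 \<and> (x + 3 - (y - 1)) mod 4 = 2"
      using assms BarF by simp
    consider "c = lattice_pt (x - 1) (y - 1)" | "c = lattice_pt (x + 3) (y - 1)"
      using assms BarF by (auto simp: lattice_pt_add)
    then show ?thesis
    proof cases
      case 1
      then show ?thesis using z \<open>even (y - 1) \<and> _\<close>
        by - (rule exI[of _ "x - 1"], rule exI[of _ "y - 1"], rule exI[of _ 1], simp)
    next
      case 2
      then show ?thesis using e BarF \<open>even (y - 1) \<and> _\<close>
        by - (rule exI[of _ "x + 3"], rule exI[of _ "y - 1"], rule exI[of _ "- 1"], simp add: add.commute)
    qed
  next
    case BarD
    have "even (y - 2) \<and> (x - (y - 2)) mod 4 = 2" using assms BarD by simp presburger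
    then show ?thesis using assms e BarD
      by - (rule exI[of _ x], rule exI[of _ "y - 2"], rule exI[of _ 1], simp add: lattice_pt_add)
  qed
qed

lemma beneath_touch:
  assumes "c \<in> beneath (lattice_pt x y) w" "on_packing (lattice_pt x y) w"
  shows "\<exists>a b i. c = lattice_pt a b \<and> c \<in> centers \<and> \<bar>i\<bar> = 1
    \<and> lattice_pt (a + i) (b + 1) \<in> path_points (lattice_pt x y) w"
  using assms
proof (induction w arbitrary: x y)
  case (Cons s w)
  show ?case
  proof (cases "c \<in> beneath_step (lattice_pt x y) s")
    case True
    then show ?thesis using beneath_step_touch[of c x y s] Cons.prems(2) by auto
  next
    case False
    then show ?thesis using Cons.IH[of "x + step_dx s" "y + step_dy s"] Cons.prems by auto
  qed
qed simp

lemma arc_points_bounds: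
  assumes "p \<in> arc_points z s"
  shows "Re z \<le> Re p" "Re p \<le> Re (arc_end z s)"
    and "upper_arc s \<Longrightarrow> Im (arc_center z s) \<le> Im p"
    and "\<not> upper_arc s \<Longrightarrow> Im p \<le> Im (arc_center z s)"
proof -
  obtain x where x: "x \<in> {Re z..Re (arc_end z s)}" and p: "p = Complex x (arc_height z s x)"
    using assms by (auto simp: arc_points_eq_graph)
  have "p \<in> sphere (arc_center z s) 2" using dist_arc_center[OF assms] by simp
  then have "\<bar>Re (arc_center z s - p)\<bar> \<le> 2"
    using abs_Re_le_cmod[of "arc_center z s - p"] by (simp add: dist_norm)
  then have "\<bar>x - Re (arc_center z s)\<bar> \<le> \<bar>2\<bar>" by (simp add: p)
  then have "0 \<le> 4 - (x - Re (arc_center z s))\<^sup>2" by (subst (asm) abs_le_square_iff) simp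
  with x p show "Re z \<le> Re p" "Re p \<le> Re (arc_end z s)"
    "upper_arc s \<Longrightarrow> Im (arc_center z s) \<le> Im p"
    "\<not> upper_arc s \<Longrightarrow> Im p \<le> Im (arc_center z s)"
    by (simp_all add: arc_height_def Let_def)
qed

text \<open>Distinct circles of the packing that share a point are tangent, and the point is the
  midpoint of the centers; \<open>(m, n)\<close> is half the difference of the centers.\<close>

lemma touching_circles:
  assumes "c \<in> centers" "c' \<in> centers" "c \<noteq> c'" "dist c p = 2" "dist c' p = 2" "c' = lattice_pt a' b'"
  obtains m n where "(m, n) \<in> {(2, 0), (- 2, 0), (1, 1), (1, - 1), (- 1, 1), (- 1, - 1)}"
    "c = lattice_pt (a' + 2 * m) (b' + 2 * n)" "p = lattice_pt (a' + m) (b' + n)"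
proof -
  obtain a b where c: "c = lattice_pt a b" "even b" "(a - b) mod 4 = 2"
    using assms(1) by (rule centersE)
  have c': "even b'" "(a' - b') mod 4 = 2" using assms(2,6) by simp_all
  have "dist c c' \<le> 4" using dist_triangle2[of c c' p] assms(4,5) by simp
  then have "(dist c c')\<^sup>2 \<le> 4\<^sup>2" by (intro power_mono) auto
  then have "real_of_int ((a - a')\<^sup>2 + 3 * (b - b')\<^sup>2) \<le> of_int 16"
    unfolding c(1) assms(6) dist_lattice_pt_sq by simp
  then have "(a - a')\<^sup>2 + 3 * (b - b')\<^sup>2 \<le> 16" by (simp only: of_int_le_iff)
  moreover have "even (b - b')" "((a - a') - (b - b')) mod 4 = 0" using c c' by presburger+
  ultimately have "(a - a', b - b') \<in> {(4, 0), (- 4, 0), (2, 2), (2, - 2), (- 2, 2), (- 2, - 2)}"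
    using center_difference(2)[of "b - b'" "a - a'"] assms(3) c(1) assms(6) by auto
  moreover define S :: "(int \<times> int) set" where "S = {(2, 0), (- 2, 0), (1, 1), (1, - 1), (- 1, 1), (- 1, - 1)}"
  ultimately have "(a - a', b - b') \<in> (\<lambda>(m, n). (2 * m, 2 * n)) ` S"
    by simp
  then obtain m n where "(m, n) \<in> S" "a - a' = 2 * m" "b - b' = 2 * n"
    by auto
  then have mn: "(m, n) \<in> {(2, 0), (- 2, 0), (1, 1), (1, - 1), (- 1, 1), (- 1, - 1)}"
    and ab: "a = a' + 2 * m" "b = b' + 2 * n"
    by (simp_all add: S_def)
  define A B where "A = real_of_int m" and "B = sqrt 3 * real_of_int n"
  define u v where "u = Re p - Re c'" and "v = Im p - Im c'"
  have AB: "A\<^sup>2 + B\<^sup>2 = 4" using mn(1) by (auto simp: A_def B_def power_mult_distrib)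
  have uv: "u\<^sup>2 + v\<^sup>2 = 4"
    using dist_complex_sq[of p c'] assms(5) by (simp add: u_def v_def dist_commute)
  have "(2 * A - u)\<^sup>2 + (2 * B - v)\<^sup>2 = (dist c p)\<^sup>2"
    unfolding dist_complex_sq
    by (simp add: A_def B_def u_def v_def c(1) assms(6) ab algebra_simps)
  then have "(2 * A - u)\<^sup>2 + (2 * B - v)\<^sup>2 = 4" by (simp add: assms(4))
  \<comment> \<open>The vectors \<open>(u, v)\<close> and \<open>(2 * A - u, 2 * B - v)\<close> and
    their mean \<open>(A, B)\<close> all have length 2, which forces the vectors to
    coincide.\<close>
  then have "(u - A)\<^sup>2 + (v - B)\<^sup>2 = 0"
    using AB uv by (simp add: power2_eq_square algebra_simps)
  then have "u = A" "v = B" by (simp_all add: sum_power2_eq_zero_iff)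
  then have "p = lattice_pt (a' + m) (b' + n)"
    by (simp add: u_def v_def A_def B_def assms(6) complex_eq_iff algebra_simps)
  with that mn c(1) ab show ?thesis by blast
qed

text \<open>The two additional circles have their rightmost point at the start of the arc, or their
  leftmost point at its end. Whether they count is decided by the neighboring step.\<close>

lemma arc_touch:
  assumes s: "arc_center (lattice_pt x y) s \<in> centers" and c: "c \<in> centers"
    and p: "p \<in> arc_points (lattice_pt x y) s" "dist c p = 2"
    and above: "\<forall>p\<in>arc_points (lattice_pt x y) s. dist c p = 2 \<longrightarrow> Im c \<le> Im p"
  shows "c \<in> beneath_step (lattice_pt x y) s \<or> c = lattice_pt (x - 2) y
    \<or> c = arc_end (lattice_pt x y) s + lattice_pt 2 0"
proof (cases "c = arc_center (lattice_pt x y) s")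
  case True
  have "lattice_pt x y \<in> arc_points (lattice_pt x y) s"
    using start_in_path_points[of "lattice_pt x y" "[s]"] arc_end_in_arc_points[of "lattice_pt x y" s]
    by auto
  then have "Im c \<le> Im (lattice_pt x y)" using above dist_arc_center True by blast
  moreover have "Im c \<le> Im (arc_end (lattice_pt x y) s)"
    using above dist_arc_center True arc_end_in_arc_points by blast
  ultimately show ?thesis
    using True by (cases s) (simp_all add: lattice_pt_add)
next
  case False
  obtain m n where mn: "(m, n) \<in> {(2, 0), (- 2, 0), (1, 1), (1, - 1), (- 1, 1), (- 1, - 1)}"
    and c_eq: "c = lattice_pt (x + center_dx s + 2 * m) (y + center_dy s + 2 * n)"
    and p_eq: "p = lattice_pt (x + center_dx s + m) (y + center_dy s + n)"
    using touching_circles[OF c s False p(2) dist_arc_center[OF p(1)]] by auto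
  have "Im c \<le> Im p" using above p by blast
  then have n: "n \<le> 0" by (simp add: c_eq p_eq)
  note b = arc_points_bounds[OF p(1)]
  have r: "0 \<le> center_dx s + m" "center_dx s + m \<le> step_dx s"
    using b(1,2) by (simp_all add: p_eq)
  have u: "upper_arc s \<Longrightarrow> 0 \<le> n"
    using b(3) by (simp add: p_eq)
  show ?thesis
    using mn n r u by (cases s) (auto simp: c_eq lattice_pt_add)
qed

text \<open>Exceptional circles survive only at the two ends of the path. At an inner joint only
  \<open>ArcU\<close> and \<open>BarD\<close> start at the leftmost point of a circle and only
  \<open>ArcD\<close> and \<open>BarU\<close> end at the rightmost one. The barred steps run below
  the center, against the last assumption; the others have the circle in their
  \<open>beneath_step\<close>.\<close>

lemma path_touch:
  assumes "w \<noteq> []" "on_packing (lattice_pt x y) w" "c \<in> centers"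
    and "p \<in> path_points (lattice_pt x y) w" "dist c p = 2"
    and "\<And>p. p \<in> path_points (lattice_pt x y) w \<Longrightarrow> dist c p = 2 \<Longrightarrow> Im c \<le> Im p"
  shows "c \<in> beneath (lattice_pt x y) w \<or> c = lattice_pt (x - 2) y
    \<or> c = path_end (lattice_pt x y) w + lattice_pt 2 0"
  using assms
proof (induction w arbitrary: x y)
  case (Cons s w)
  define X Y where "X = x + step_dx s" and "Y = y + step_dy s"
  have e: "arc_end (lattice_pt x y) s = lattice_pt X Y" by (simp add: X_def Y_def)
  have above: "Im c \<le> Im q"
    if "q \<in> arc_points (lattice_pt x y) s \<or> q \<in> path_points (lattice_pt X Y) w" "dist c q = 2" for q
    using Cons.prems(6)[of q] that by (auto simp: X_def Y_def)
  have s: "arc_center (lattice_pt x y) s \<in> centers" and w: "on_packing (lattice_pt X Y) w"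
    using Cons.prems(2) by (simp_all add: X_def Y_def)
  show ?case
  proof (cases "p \<in> arc_points (lattice_pt x y) s")
    case True
    then consider "c \<in> beneath_step (lattice_pt x y) s" | "c = lattice_pt (x - 2) y"
      | "c = lattice_pt (X + 2) Y"
      using arc_touch[OF s Cons.prems(3) True Cons.prems(5)] above e
      by (auto simp: lattice_pt_add)
    then show ?thesis
    proof cases
      case 3
      show ?thesis
      proof (cases w)
        case Nil
        then show ?thesis using 3 e by (simp add: lattice_pt_add)
      next
        case (Cons t v)
        have "t = ArcU \<or> t = BarD"
          using w 3 \<open>c \<in> centers\<close> by (cases t) (simp_all add: Cons)
        moreover have "t \<noteq> BarD"
        proof
          assume t: "t = BarD"
          have "arc_end (lattice_pt X Y) t \<in> path_points (lattice_pt X Y) w"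
            using arc_end_in_arc_points[of "lattice_pt X Y" t] by (simp add: Cons)
          moreover have "dist c (arc_end (lattice_pt X Y) t) = 2"
            using dist_arc_center[OF arc_end_in_arc_points, of "lattice_pt X Y" t] by (simp add: 3 t)
          ultimately have "Im c \<le> Im (arc_end (lattice_pt X Y) t)" using above by blast
          then show False by (simp add: 3 t)
        qed
        ultimately show ?thesis using 3 e by (simp add: Cons lattice_pt_add)
      qed
    qed auto
  next
    case False
    then have p: "p \<in> path_points (lattice_pt X Y) w" using Cons.prems(4) e by simp
    have "w \<noteq> []"
      using p False arc_end_in_arc_points[of "lattice_pt x y" s] e by (cases w) auto
    then consider "c \<in> beneath (lattice_pt X Y) w" | "c = lattice_pt (X - 2) Y"
      | "c = path_end (lattice_pt X Y) w + lattice_pt 2 0"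
      using Cons.IH[OF _ w Cons.prems(3) p Cons.prems(5)] above by blast
    then show ?thesis
    proof cases
      case 2
      have "s = ArcD \<or> s = BarU"
        using s 2 \<open>c \<in> centers\<close> by (cases s) (simp_all add: X_def Y_def)
      moreover have "s \<noteq> BarU"
      proof
        assume s: "s = BarU"
        have z: "lattice_pt x y \<in> arc_points (lattice_pt x y) s"
          using start_in_path_points[of "lattice_pt x y" "[s]"]
            arc_end_in_arc_points[of "lattice_pt x y" s]
          by auto
        moreover have "dist c (lattice_pt x y) = 2"
          using dist_arc_center[OF z] by (simp add: 2 s X_def Y_def)
        ultimately have "Im c \<le> Im (lattice_pt x y)" using above by blast
        then show False by (simp add: 2 s X_def Y_def)
      qed
      ultimately show ?thesis using 2 by (simp add: X_def Y_def lattice_pt_add)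
    qed (use e in auto)
  qed
qed simp

text \<open>The two exceptional circles of \<open>path_touch\<close> stick out beyond the abscissas
  allowed by \<open>under_pathD\<close>. Conversely, a contact point
  \<open>lattice_pt (a + i) (b + 1)\<close> of nonnegative ordinate gives \<open>b \<ge> -1\<close>,
  and \<open>b\<close> is even.\<close>

lemma kissed_circles_eq_beneath:
  assumes w: "w \<in> packing_paths"
  shows "kissed_circles w = beneath 0 w"
proof
  have on: "on_packing 0 w" and pos: "\<And>p. p \<in> path_points 0 w \<Longrightarrow> 0 \<le> Im p"
    and e: "Im (path_end 0 w) = 0"
    using w by (auto simp: packing_paths_def)
  show "kissed_circles w \<subseteq> beneath 0 w"
  proof
    fix c assume "c \<in> kissed_circles w"
    then obtain p where c: "c \<in> centers" "under_path w c" "p \<in> path_points 0 w" "dist c p = 2"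
      by (auto simp: kissed_circles_def)
    note u = under_pathD[OF c(2)]
    have ne: "w \<noteq> []" using u by auto
    have "c \<in> beneath 0 w \<or> c = lattice_pt (0 - 2) 0 \<or> c = path_end 0 w + lattice_pt 2 0"
      using path_touch[OF ne, of 0 0] on c u(3) unfolding lattice_pt_0_0[symmetric] by blast
    then show "c \<in> beneath 0 w" using u(1,2) by auto
  qed
  show "beneath 0 w \<subseteq> kissed_circles w"
  proof
    fix c assume "c \<in> beneath 0 w"
    then obtain a b i where c: "c = lattice_pt a b" "c \<in> centers" "\<bar>i\<bar> = 1"
      and q: "lattice_pt (a + i) (b + 1) \<in> path_points 0 w"
      using beneath_touch[of c 0 0 w] on by (auto simp flip: lattice_pt_0_0)
    have "0 \<le> Im (lattice_pt (a + i) (b + 1))" using q by (rule pos)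
    then have "0 \<le> real_of_int (b + 1)" by (simp add: zero_le_mult_iff)
    then have "- 1 \<le> b" by simp
    moreover have "even b" using c by simp
    ultimately have "0 \<le> b" by presburger
    then have c0: "0 \<le> Im c" by (simp add: c(1))
    have i: "\<bar>real_of_int i\<bar> = 1" using c(3) by linarith
    have "i\<^sup>2 = 1" using c(3) by (simp add: abs_square_eq_1)
    then have "(dist c (lattice_pt (a + i) (b + 1)))\<^sup>2 = 2\<^sup>2"
      unfolding c(1) dist_lattice_pt_sq by simp
    then have "dist c (lattice_pt (a + i) (b + 1)) = 2"
      using power2_eq_imp_eq zero_le_dist by (metis zero_le_numeral)
    moreover have "under_path w c"
      using i by (intro under_pathI[OF on e c(2) c0 q]) (simp_all add: c(1))
    ultimately show "c \<in> kissed_circles w"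
      using c c0 q by (auto simp: kissed_circles_def)
  qed
qed

section \<open>Coding inchworm paths by Motzkin words\<close>

text \<open>A cursor standing at the \<open>120\<close> degree point (\<open>True\<close>) or at the \<open>60\<close> degree point (\<open>False\<close>)
  of a circle in row \<open>h\<close> reads the rest of a path and writes the remaining Motzkin steps.\<close>

inductive traces :: "bool \<Rightarrow> nat \<Rightarrow> step list \<Rightarrow> mstep list \<Rightarrow> bool" where
  cross: "traces False h w m \<Longrightarrow> traces True h (ArcF # w) (MF # m)"
| climb: "traces True (Suc h) w m \<Longrightarrow> traces True h (BarU # ArcU # w) (MU # m)"
| stop: "traces False 0 [ArcD] []"
| descend: "traces False h w m \<Longrightarrow> traces False (Suc h) (ArcD # BarD # w) (MD # m)"
| slide: "traces True h w m \<Longrightarrow> traces False h (BarF # w) m"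

text \<open>At a 120 degree point the path neither stops nor descends. This yields both the absence
  of peaks and the unique readability of the word.\<close>

lemma traces_True_head:
  "traces b h w m \<Longrightarrow> b \<Longrightarrow> \<exists>m'. m = MF # m' \<or> m = MU # m'"
  by (induction rule: traces.induct) auto

text \<open>The delicate rule is \<open>slide\<close>, which writes nothing. In state
  \<open>False\<close> a next letter \<open>MF\<close> or \<open>MU\<close> forces it, while
  \<open>MD\<close> or the end of the word excludes it.\<close>

lemma traces_injective: "traces b h w m \<Longrightarrow> traces b h w' m \<Longrightarrow> w = w'"
proof (induction arbitrary: w' rule: traces.induct)
  case cross
  from cross.prems show ?case by cases (use cross.IH in auto)
next
  case climb
  from climb.prems show ?case by cases (use climb.IH in auto)
next
  case stop
  then show ?case by cases (use traces_True_head in fastforce)+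
next
  case (descend h w m)
  from descend.prems show ?case
    by cases (use descend.IH traces_True_head[of True "Suc h" _ "MD # m"] in auto)
next
  case (slide h w m)
  obtain m1 where "m = MF # m1 \<or> m = MU # m1" using traces_True_head[OF slide.hyps] by auto
  with slide.prems slide.IH show ?case by cases auto
qed

text \<open>Carrying the remaining height suits induction on tails better than the prefix heights in
  \<open>motzkin_paths\<close>.\<close>

fun returns :: "int \<Rightarrow> mstep list \<Rightarrow> bool" where
  "returns h [] \<longleftrightarrow> h = 0"
| "returns h (s # m) \<longleftrightarrow> 0 \<le> h \<and> returns (h + mrise s) m"

lemma returns_nonneg: "returns h m \<Longrightarrow> 0 \<le> h"
  by (cases m) auto

lemma returns_iff:
  "returns h m \<longleftrightarrow> (\<forall>n\<le>length m. 0 \<le> h + mheight (take n m)) \<and> h + mheight m = 0"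
proof (induction m arbitrary: h)
  case (Cons s m)
  have "(\<forall>n\<le>length (s # m). 0 \<le> h + mheight (take n (s # m)))
      \<longleftrightarrow> 0 \<le> h \<and> (\<forall>n\<le>length m. 0 \<le> h + mrise s + mheight (take n m))"
    (is "(\<forall>n\<le>_. ?P n) \<longleftrightarrow> _ \<and> (\<forall>n\<le>_. ?Q n)")
  proof -
    have "(\<forall>n\<le>length (s # m). ?P n) \<longleftrightarrow> ?P 0 \<and> (\<forall>n\<le>length m. ?P (Suc n))"
      by (metis Suc_le_mono length_Cons not0_implies_Suc zero_le)
    then show ?thesis by (simp add: mheight_def add.assoc)
  qed
  with Cons.IH[of "h + mrise s"] show ?case by (simp add: mheight_def add.assoc)
qed (auto simp: mheight_def)

lemma returns_mheight: "returns h m \<Longrightarrow> mheight m = - h"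
  by (simp add: returns_iff)

lemma sublist_pair_Cons:
  "sublist [a, b] (x # xs) \<longleftrightarrow> x = a \<and> (\<exists>ys. xs = b # ys) \<or> sublist [a, b] xs"
  by (cases xs) (auto simp: sublist_Cons_right)

lemma peakless_motzkin_paths_iff:
  "m \<in> peakless_motzkin_paths \<longleftrightarrow> returns 0 m \<and> \<not> sublist [MU, MD] m"
  by (simp add: peakless_motzkin_paths_def motzkin_paths_def returns_iff)

lemma traces_returns:
  "traces b h w m \<Longrightarrow> returns (int h) m \<and> \<not> sublist [MU, MD] m"
proof (induction rule: traces.induct)
  case (climb h w m)
  then show ?case
    using traces_True_head[OF climb.hyps] by (auto simp: sublist_pair_Cons add.commute)
qed (auto simp: sublist_pair_Cons)

text \<open>The restriction in state \<open>True\<close> is that of \<open>traces_True_head\<close>.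
  In state \<open>False\<close> a leading \<open>MU\<close> or \<open>MF\<close> is prepared by a
  \<open>slide\<close> into state \<open>True\<close>.\<close>

lemma returns_traces:
  assumes "returns (int h) m" "\<not> sublist [MU, MD] m"
  shows "(\<exists>w. traces False h w m) \<and> ((m \<noteq> [] \<and> hd m \<noteq> MD) \<longrightarrow> (\<exists>w. traces True h w m))"
  using assms
proof (induction m arbitrary: h)
  case Nil
  then show ?case by (auto intro: traces.stop)
next
  case (Cons s m)
  have pk: "\<not> sublist [MU, MD] m" using Cons.prems by (simp add: sublist_pair_Cons)
  show ?case
  proof (cases s)
    case MU
    have r: "returns (int (Suc h)) m" using Cons.prems MU by (simp add: add.commute)
    then have "m \<noteq> []" by auto
    then have "hd m \<noteq> MD" using Cons.prems MU by (cases m) (auto simp: sublist_pair_Cons)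
    then obtain w where "traces True (Suc h) w m" using Cons.IH[OF r pk] \<open>m \<noteq> []\<close> by blast
    then show ?thesis using MU by (blast intro: traces.climb traces.slide)
  next
    case MF
    then obtain w where "traces False h w m" using Cons.IH[OF _ pk, of h] Cons.prems by auto
    then show ?thesis using MF by (blast intro: traces.cross traces.slide)
  next
    case MD
    have r: "returns (int h - 1) m" using Cons.prems MD by simp
    then obtain k where k: "h = Suc k" using returns_nonneg[OF r] by (cases h) auto
    then obtain w where "traces False k w m" using Cons.IH[OF _ pk, of k] r by auto
    then show ?thesis using MD k by (auto intro: traces.descend)
  qed
qed

text \<open>An arbitrary starting point allows induction along the path.\<close>

definition admissible :: "complex \<Rightarrow> step list \<Rightarrow> bool" where
  "admissible z w \<longleftrightarrow> on_packing z w \<and> (\<forall>p\<in>path_points z w. 0 \<le> Im p) \<and> Im (path_end z w) = 0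
     \<and> \<not> sublist [BarU, BarD] w \<and> \<not> sublist [ArcD, ArcU] w"

lemma inchworm_paths_iff: "w \<in> inchworm_paths \<longleftrightarrow> admissible 0 w"
proof -
  have "0 \<le> Re p" if "p \<in> path_points 0 w" for p
  proof -
    obtain f where "path_points 0 w = (\<lambda>u. Complex u (f u)) ` {0..Re (path_end 0 w)}"
      using path_points_0_graph by blast
    with that show ?thesis by auto
  qed
  then show ?thesis by (auto simp: inchworm_paths_def packing_paths_def admissible_def)
qed

text \<open>Checking the endpoints suffices. Since centers have an even second coordinate, that of
  an upper arc is at least 0 and that of a lower arc at least 2; the latter means height at least
  \<open>2 * sqrt 3\<close>, more than the radius.\<close>

lemma arc_points_nonneg:
  assumes "arc_center (lattice_pt x y) s \<in> centers" "0 \<le> y" "0 \<le> y + step_dy s"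
    and p: "p \<in> arc_points (lattice_pt x y) s"
  shows "0 \<le> Im p"
proof (cases "upper_arc s")
  case True
  have "even (y + center_dy s)" using assms(1) by simp
  then have "0 \<le> y + center_dy s" using assms(2,3) True by (cases s) (simp_all, presburger)
  then have "0 \<le> sqrt 3 * real_of_int (y + center_dy s)" by simp
  also have "\<dots> \<le> Im p" using arc_points_bounds(3)[OF p True] by simp
  finally show ?thesis .
next
  case False
  have "even (y + center_dy s)" using assms(1) by simp
  then have "2 \<le> y + center_dy s" using assms(2,3) False by (cases s) (simp_all, presburger+)
  then have "sqrt 3 * 2 \<le> Im (arc_center (lattice_pt x y) s)"
    by (simp flip: of_int_add)
  moreover have "Im (arc_center (lattice_pt x y) s) - Im p \<le> 2"
    using abs_Im_le_cmod[of "arc_center (lattice_pt x y) s - p"] dist_arc_center[OF p]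
    unfolding dist_norm minus_complex.sel by linarith
  moreover have "1 \<le> sqrt 3" by simp
  ultimately show ?thesis by linarith
qed

lemma admissible_Nil: "admissible z [] \<longleftrightarrow> Im z = 0"
  by (auto simp: admissible_def)

lemma admissible_Cons:
  "admissible (lattice_pt x y) (s # w) \<longleftrightarrow>
     lattice_pt (x + center_dx s) (y + center_dy s) \<in> centers \<and> 0 \<le> y
     \<and> admissible (lattice_pt (x + step_dx s) (y + step_dy s)) w
     \<and> \<not> (s = BarU \<and> (\<exists>v. w = BarD # v)) \<and> \<not> (s = ArcD \<and> (\<exists>v. w = ArcU # v))"
  (is "?L \<longleftrightarrow> ?R")
proof
  assume L: ?L
  then have "0 \<le> Im (lattice_pt x y)"
    using start_in_path_points unfolding admissible_def by blast
  then have "0 \<le> y" by (simp add: zero_le_mult_iff)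
  with L show ?R by (auto simp: admissible_def sublist_pair_Cons)
next
  assume R: ?R
  then have "0 \<le> Im (lattice_pt (x + step_dx s) (y + step_dy s))"
    using start_in_path_points unfolding admissible_def by blast
  then have "0 \<le> real_of_int (y + step_dy s)" by (simp add: zero_le_mult_iff)
  then have "0 \<le> y + step_dy s" by linarith
  then have "0 \<le> Im p" if "p \<in> arc_points (lattice_pt x y) s" for p
    using R that by (intro arc_points_nonneg) auto
  with R show ?L by (auto simp: admissible_def sublist_pair_Cons)
qed

text \<open>The residue identifies the cursor: 0 at the 120 degree point of the circle around
  \<open>lattice_pt (x + 1) (2 * int h)\<close>, 2 at the 60 degree point of the one around
  \<open>lattice_pt (x - 1) (2 * int h)\<close>.\<close>

lemma traces_admissible:
  "traces b h w m \<Longrightarrow> (x - (2 * int h + 1)) mod 4 = (if b then 0 else 2) \<Longrightarrow>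
    admissible (lattice_pt x (2 * int h + 1)) w"
proof (induction arbitrary: x rule: traces.induct)
  case (cross h w m)
  have "(x + 2 - (2 * int h + 1)) mod 4 = 2" using cross.prems by simp presburger
  then have "admissible (lattice_pt (x + 2) (2 * int h + 1)) w" using cross.IH by simp
  moreover have "(x + 1 - 2 * int h) mod 4 = 2" using cross.prems by simp presburger
  ultimately show ?case by (simp add: admissible_Cons)
next
  case (climb h w m)
  have "(x + 2 - (2 * int (Suc h) + 1)) mod 4 = 0" using climb.prems by simp presburger
  then have "admissible (lattice_pt (x + 2) (2 * int (Suc h) + 1)) w" using climb.IH by simp
  moreover have "lattice_pt (x + 2) (2 * int (Suc h) + 1) = lattice_pt (x + 1 + 1) (2 * int h + 1 + 1 + 1)"
    by simp
  ultimately have "admissible (lattice_pt (x + 1 + 1) (2 * int h + 1 + 1 + 1)) w" by metis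
  moreover have "(x - 1 - (2 * int h + 2)) mod 4 = 2" "(x + 1 + 2 - (2 * int h + 2)) mod 4 = 2"
    using climb.prems by (simp, presburger)+
  ultimately show ?case by (simp add: admissible_Cons)
next
  case stop
  then show ?case by (simp add: admissible_Cons admissible_Nil)
next
  case (descend h w m)
  have "(x + 2 - (2 * int h + 1)) mod 4 = 2" using descend.prems by simp presburger
  then have "admissible (lattice_pt (x + 2) (2 * int h + 1)) w" using descend.IH by simp
  moreover have "lattice_pt (x + 2) (2 * int h + 1) = lattice_pt (x + 1 + 1) (2 * int (Suc h) + 1 - 1 - 1)"
    by simp
  ultimately have "admissible (lattice_pt (x + 1 + 1) (2 * int (Suc h) + 1 - 1 - 1)) w" by metis
  moreover have "(x - 1 - (2 * int h + 2)) mod 4 = 2" "(x + 1 + 2 - (2 * int h + 2)) mod 4 = 2"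
    using descend.prems by (simp, presburger)+
  ultimately show ?case by (simp add: admissible_Cons)
next
  case (slide h w m)
  have "(x + 2 - (2 * int h + 1)) mod 4 = 0" using slide.prems by simp presburger
  then have "admissible (lattice_pt (x + 2) (2 * int h + 1)) w" using slide.IH by simp
  moreover have "(x + 1 - (2 * int h + 2)) mod 4 = 2" using slide.prems by simp presburger
  ultimately show ?case by (simp add: admissible_Cons)
qed

text \<open>The residue leaves two steps at each cursor, and the forbidden pairs fix what may follow
  \<open>BarU\<close> and \<open>ArcD\<close>. The induction is on length because climbing and
  descending consume two steps.\<close>

lemma admissible_traces:
  assumes "admissible (lattice_pt x (2 * int h + 1)) w"
    "(x - (2 * int h + 1)) mod 4 = (if b then 0 else 2)"
  shows "\<exists>m. traces b h w m"
  using assms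
proof (induction w arbitrary: x h b rule: length_induct)
  case (1 w)
  note IH = "1.IH"[rule_format]
  have "w \<noteq> []"
  proof
    assume "w = []"
    then have "real_of_int (2 * int h + 1) = 0" using "1.prems"(1) by (simp add: admissible_Nil)
    then show False by linarith
  qed
  then obtain s v where w: "w = s # v" by (cases w) auto
  note adm = "1.prems"(1)[unfolded w admissible_Cons]
  show ?case
  proof (cases b)
    case True
    have m: "(x - (2 * int h + 1)) mod 4 = 0" using "1.prems"(2) True by simp
    have "s = ArcF \<or> s = BarU" using adm m by (cases s) (simp_all add: algebra_simps)
    then show ?thesis
    proof
      assume s: "s = ArcF"
      have "(x + 2 - (2 * int h + 1)) mod 4 = 2" using m by presburger
      then obtain k where "traces False h v k" using IH[of v "x + 2" h False] adm s w by auto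
      then show ?thesis using True s w by (auto intro: traces.cross)
    next
      assume s: "s = BarU"
      have a: "admissible (lattice_pt (x + 1) (2 * int h + 2)) v" using adm s by (simp add: add.commute)
      have "v \<noteq> []"
      proof
        assume "v = []"
        then have "real_of_int (2 * int h + 2) = 0" using a by (simp add: admissible_Nil)
        then show False by linarith
      qed
      then obtain t u where v: "v = t # u" by (cases v) auto
      note a' = a[unfolded v admissible_Cons]
      have "t = ArcU \<or> t = BarD" using a' m by (cases t) simp_all
      then have t: "t = ArcU" using adm s v by auto
      have "lattice_pt (x + 1 + 1) (2 * int h + 2 + 1) = lattice_pt (x + 2) (2 * int (Suc h) + 1)"
        by simp
      then have "admissible (lattice_pt (x + 2) (2 * int (Suc h) + 1)) u"
        using a' t by (metis step_dx.simps(1) step_dy.simps(1))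
      moreover have "(x + 2 - (2 * int (Suc h) + 1)) mod 4 = 0" using m by simp presburger
      ultimately obtain k where "traces True (Suc h) u k"
        using IH[of u "x + 2" "Suc h" True] v w by auto
      then show ?thesis using True s t v w by (auto intro: traces.climb)
    qed
  next
    case False
    have m: "(x - (2 * int h + 1)) mod 4 = 2" using "1.prems"(2) False by simp
    have "even (2 * int h + 1 + center_dy s) \<and>
        (x + center_dx s - (2 * int h + 1 + center_dy s)) mod 4 = 2"
      using adm by simp
    then have "s = ArcD \<or> s = BarF" using m by (cases s) (simp_all add: algebra_simps, presburger+)
    then show ?thesis
    proof
      assume s: "s = BarF"
      have "(x + 2 - (2 * int h + 1)) mod 4 = 0" using m by presburger
      then obtain k where "traces True h v k" using IH[of v "x + 2" h True] adm s w by auto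
      then show ?thesis using False s w by (auto intro: traces.slide)
    next
      assume s: "s = ArcD"
      have a: "admissible (lattice_pt (x + 1) (2 * int h)) v" using adm s by simp
      show ?thesis
      proof (cases v)
        case Nil
        then have "h = 0" using a by (simp add: admissible_Nil)
        then show ?thesis using False s Nil w by (auto intro: traces.stop)
      next
        case (Cons t u)
        note a' = a[unfolded Cons admissible_Cons]
        have "t = ArcU \<or> t = BarD" using a' by (cases t) simp_all
        then have t: "t = BarD" using adm s Cons by auto
        have a'': "admissible (lattice_pt (x + 1 + 1) (2 * int h - 1)) u" using a' t by simp
        \<comment> \<open>In row 0 the step \<open>BarD\<close> would end below the axis, so there
          the path can only stop.\<close>
        then have "0 \<le> Im (lattice_pt (x + 1 + 1) (2 * int h - 1))"
          using start_in_path_points unfolding admissible_def by blast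
        then have "0 \<le> real_of_int (2 * int h - 1)" by (simp add: zero_le_mult_iff)
        then obtain k where k: "h = Suc k" by (cases h) auto
        have "lattice_pt (x + 1 + 1) (2 * int h - 1) = lattice_pt (x + 2) (2 * int k + 1)"
          by (simp add: k)
        then have "admissible (lattice_pt (x + 2) (2 * int k + 1)) u" using a'' by metis
        moreover have "(x + 2 - (2 * int k + 1)) mod 4 = 2" using m by (simp add: k) presburger
        ultimately obtain n where "traces False k u n"
          using IH[of u "x + 2" k False] Cons w by auto
        then show ?thesis using False s t Cons w k by (auto intro: traces.descend)
      qed
    qed
  qed
qed

text \<open>The initial \<open>ArcU\<close> leads from the origin to the 120 degree point of the
  first circle and writes nothing.\<close>

definition codes :: "step list \<Rightarrow> mstep list \<Rightarrow> bool" where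
  "codes w m \<longleftrightarrow> w = [] \<and> m = [] \<or> (\<exists>v. w = ArcU # v \<and> traces True 0 v m)"

lemma codes_injective: "codes w m \<Longrightarrow> codes w' m \<Longrightarrow> w = w'"
  by (auto simp: codes_def dest: traces_injective traces_True_head)

lemma inchworm_paths_codes:
  assumes "w \<in> inchworm_paths"
  obtains m where "codes w m"
proof (cases w)
  case Nil
  then show ?thesis using that by (simp add: codes_def)
next
  case (Cons s v)
  have a: "admissible (lattice_pt 0 0) (s # v)"
    using assms Cons by (simp add: inchworm_paths_iff flip: lattice_pt_0_0)
  note a' = a[unfolded admissible_Cons]
  have "s = ArcU \<or> s = BarD" using a' by (cases s) simp_all
  moreover have "s \<noteq> BarD"
  proof
    assume "s = BarD"
    then have "0 \<le> Im (lattice_pt 1 (- 1))"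
      using a' start_in_path_points unfolding admissible_def by force
    then show False by simp
  qed
  ultimately have "admissible (lattice_pt 1 (2 * int 0 + 1)) v" "s = ArcU" using a' by auto
  then obtain m where "traces True 0 v m" using admissible_traces[of 1 0 v True] by auto
  then show ?thesis using that Cons \<open>s = ArcU\<close> by (auto simp: codes_def)
qed

lemma codes_inchworm_paths:
  assumes "codes w m"
  shows "w \<in> inchworm_paths"
proof -
  have "admissible (lattice_pt 0 0) w"
    using assms traces_admissible[of True 0 _ m 1]
    by (auto simp: codes_def admissible_Cons admissible_Nil)
  then show ?thesis by (simp add: inchworm_paths_iff flip: lattice_pt_0_0)
qed

lemma codes_peakless: "codes w m \<Longrightarrow> m \<in> peakless_motzkin_paths"
  using traces_returns[of True 0 _ m] by (auto simp: codes_def peakless_motzkin_paths_iff)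

lemma peakless_codes:
  assumes "m \<in> peakless_motzkin_paths"
  obtains w where "codes w m"
proof (cases m)
  case Nil
  then show ?thesis using that[of "[]"] by (simp add: codes_def)
next
  case (Cons s n)
  have m: "returns (int 0) m" "\<not> sublist [MU, MD] m"
    using assms by (simp_all add: peakless_motzkin_paths_iff)
  have "s \<noteq> MD" using m(1) returns_nonneg[of "- 1" n] Cons by auto
  then obtain w where "traces True 0 w m" using returns_traces[OF m] Cons by auto
  then show ?thesis using that by (auto simp: codes_def)
qed

text \<open>The circles below the path coded by a Motzkin word: \<open>lattice_pt x y\<close> is the circle of the next
  step as long as that step is not \<open>MD\<close>. A step \<open>MU\<close> or \<open>MF\<close> stands for a circle in the row of its
  starting height, a step \<open>MD\<close> for one in the row of its final height.\<close>

fun circles_from :: "int \<Rightarrow> int \<Rightarrow> mstep list \<Rightarrow> complex list" where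
  "circles_from x y [] = []"
| "circles_from x y (MF # m) = lattice_pt x y # circles_from (x + 4) y m"
| "circles_from x y (MU # m) = lattice_pt x y # circles_from (x + 2) (y + 2) m"
| "circles_from x y (MD # m) = lattice_pt (x - 2) (y - 2) # circles_from (x + 2) (y - 2) m"

lemma length_circles_from [simp]: "length (circles_from x y m) = length m"
  by (induction x y m rule: circles_from.induct) auto

lemma circles_from_eq_Nil [simp]: "circles_from x y m = [] \<longleftrightarrow> m = []"
  by (metis length_0_conv length_circles_from)

text \<open>In state \<open>True\<close> the circle of the cursor is the next one to be listed. In
  state \<open>False\<close> it has been listed already, but \<open>ArcD\<close> and
  \<open>BarF\<close> touch it again, so the equality holds up to this circle.\<close>

lemma traces_beneath:
  "traces b h w m \<Longrightarrow>
    (if b then insert (lattice_pt (x + 1) (y - 1)) (beneath (lattice_pt x y) w)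
        = set (circles_from (x + 1) (y - 1) m)
     else insert (lattice_pt (x - 1) (y - 1)) (beneath (lattice_pt x y) w)
        = insert (lattice_pt (x - 1) (y - 1)) (set (circles_from (x + 3) (y - 1) m)))"
proof (induction arbitrary: x y rule: traces.induct)
  case (cross h w m)
  show ?case using cross.IH[of "x + 2" y] by (simp add: lattice_pt_add add.commute)
next
  case (climb h w m)
  show ?case using climb.IH[of "x + 2" "y + 2"] by (simp add: lattice_pt_add algebra_simps)
next
  case stop
  show ?case by (simp add: lattice_pt_add)
next
  case (descend h w m)
  show ?case using descend.IH[of "x + 2" "y - 2"] by (simp add: lattice_pt_add algebra_simps insert_commute)
next
  case (slide h w m)
  show ?case using slide.IH[of "x + 2" y] by (simp add: lattice_pt_add algebra_simps)
qed

lemma codes_beneath: "codes w m \<Longrightarrow> beneath 0 w = set (circles_from 2 0 m)"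
  using traces_beneath[of True 0 _ m 1 1] by (auto simp: codes_def lattice_pt_0_0 lattice_pt_add)

text \<open>\<open>MD\<close> writes 2 to the left of the current abscissa, whence the weaker bound.
  Only \<open>MU MD\<close> could spoil the order, as both letters would write
  \<open>lattice_pt x y\<close>; without peaks the sharper bound holds after every
  \<open>MU\<close>.\<close>

lemma circles_from_sorted_bound:
  assumes "\<not> sublist [MU, MD] m"
  shows "sorted_wrt (\<lambda>a b. Re a < Re b) (circles_from x y m)
    \<and> (\<forall>c\<in>set (circles_from x y m). of_int x - 2 \<le> Re c)
    \<and> ((\<forall>n. m \<noteq> MD # n) \<longrightarrow> (\<forall>c\<in>set (circles_from x y m). of_int x \<le> Re c))"
  using assms
proof (induction x y m rule: circles_from.induct)
  case (2 x y m)
  then have s: "sorted_wrt (\<lambda>a b. Re a < Re b) (circles_from (x + 4) y m)"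
    and b: "\<forall>c\<in>set (circles_from (x + 4) y m). 2 + of_int x \<le> Re c"
    by (simp_all add: sublist_pair_Cons)
  have "of_int x < Re c \<and> of_int x - 2 \<le> Re c \<and> of_int x \<le> Re c"
    if "c \<in> set (circles_from (x + 4) y m)" for c
    using bspec[OF b that] by linarith
  with s show ?case by simp
next
  case (3 x y m)
  then have s: "sorted_wrt (\<lambda>a b. Re a < Re b) (circles_from (x + 2) (y + 2) m)"
    and b: "\<forall>c\<in>set (circles_from (x + 2) (y + 2) m). of_int x + 2 \<le> Re c"
    by (simp_all add: sublist_pair_Cons)
  have "of_int x < Re c \<and> of_int x - 2 \<le> Re c \<and> of_int x \<le> Re c"
    if "c \<in> set (circles_from (x + 2) (y + 2) m)" for c
    using bspec[OF b that] by linarith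
  with s show ?case by simp
next
  case (4 x y m)
  then have s: "sorted_wrt (\<lambda>a b. Re a < Re b) (circles_from (x + 2) (y - 2) m)"
    and b: "\<forall>c\<in>set (circles_from (x + 2) (y - 2) m). of_int x \<le> Re c"
    by (simp_all add: sublist_pair_Cons)
  have "of_int x - 2 < Re c \<and> of_int x - 2 \<le> Re c"
    if "c \<in> set (circles_from (x + 2) (y - 2) m)" for c
    using bspec[OF b that] by linarith
  with s show ?case by simp
qed simp

lemma circles_from_sorted:
  "\<not> sublist [MU, MD] m \<Longrightarrow> sorted_wrt (\<lambda>a b. Re a < Re b) (circles_from x y m)"
  using circles_from_sorted_bound by blast

text \<open>This makes the description in \<open>circle_seq\<close> unique: two different heads
  would each have to precede the other.\<close>

lemma sorted_wrt_set_unique: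
  assumes "\<And>a b. R a b \<Longrightarrow> \<not> R b a" "sorted_wrt R xs" "sorted_wrt R ys" "set xs = set ys"
  shows "xs = ys"
  using assms(2-)
proof (induction xs arbitrary: ys)
  case (Cons x xs)
  then obtain y zs where ys: "ys = y # zs" by (cases ys) auto
  have "x = y"
  proof (rule ccontr)
    assume "x \<noteq> y"
    then have "x \<in> set zs" "y \<in> set xs" using Cons.prems(3) ys by auto
    then show False using Cons.prems(1,2) ys assms(1) by auto
  qed
  moreover have "x \<notin> set xs" "y \<notin> set zs" using Cons.prems(1,2) ys assms(1) by auto
  then have "set xs = set zs" using Cons.prems(3) ys \<open>x = y\<close> by auto
  ultimately show ?case using Cons.IH[of zs] Cons.prems(1,2) ys by simp
qed simp

lemma kissed_circles_codes:
  assumes "codes w m"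
  shows "kissed_circles w = set (circles_from 2 0 m)"
proof -
  have "w \<in> packing_paths"
    using codes_inchworm_paths[OF assms] by (simp add: inchworm_paths_def)
  then show ?thesis using kissed_circles_eq_beneath codes_beneath[OF assms] by simp
qed

lemma circle_seq_codes:
  assumes "codes w m"
  shows "circle_seq w = circles_from 2 0 m"
proof -
  have "sorted_wrt (\<lambda>a b. Re a < Re b) (circles_from 2 0 m)"
    using codes_peakless[OF assms] by (simp add: circles_from_sorted peakless_motzkin_paths_iff)
  then show ?thesis
    unfolding circle_seq_def kissed_circles_codes[OF assms]
    by (intro the_equality conjI refl) (auto intro!: sorted_wrt_set_unique[where R = "\<lambda>a b. Re a < Re b"])
qed

lemma kissing_number_codes:
  assumes "codes w m"
  shows "kissing_number w = length m"
proof -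
  have "sorted_wrt (\<lambda>a b. Re a < Re b) (circles_from 2 0 m)"
    using codes_peakless[OF assms] by (simp add: circles_from_sorted peakless_motzkin_paths_iff)
  then have "sorted_wrt (<) (map Re (circles_from 2 0 m))" by (simp add: sorted_wrt_map)
  then have "distinct (circles_from 2 0 m)" by (simp add: strict_sorted_iff distinct_map)
  then show ?thesis
    by (simp add: kissing_number_def kissed_circles_codes[OF assms] distinct_card)
qed

text \<open>From here on the argument is purely combinatorial.\<close>

lemma inchworm_seqs_eq: "inchworm_seqs = circles_from 2 0 ` peakless_motzkin_paths"
proof (intro equalityI subsetI)
  fix C assume "C \<in> inchworm_seqs"
  then obtain w where w: "C = circle_seq w" "w \<in> inchworm_paths"
    by (auto simp: inchworm_seqs_def)
  obtain m where "codes w m" using w(2) by (rule inchworm_paths_codes)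
  then show "C \<in> circles_from 2 0 ` peakless_motzkin_paths"
    by (auto simp: w(1) circle_seq_codes codes_peakless)
next
  fix C assume "C \<in> circles_from 2 0 ` peakless_motzkin_paths"
  then obtain m where m: "C = circles_from 2 0 m" "m \<in> peakless_motzkin_paths" by blast
  obtain w where w: "codes w m" using m(2) by (rule peakless_codes)
  have "C = circle_seq w" using circle_seq_codes[OF w] m(1) by simp
  then show "C \<in> inchworm_seqs"
    unfolding inchworm_seqs_def using codes_inchworm_paths[OF w] by blast
qed

section \<open>The recursive description of \<open>g\<close>\<close>

lemma circles_from_translate:
  "circles_from (x + a) (y + b) m = translate (lattice_pt a b) (circles_from x y m)"
proof (induction m arbitrary: x y)
  case (Cons s m)
  show ?case
    using Cons.IH[of "x + 4" y] Cons.IH[of "x + 2" "y + 2"] Cons.IH[of "x + 2" "y - 2"]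
    by (cases s) (simp_all add: translate_def lattice_pt_add algebra_simps)
qed (simp add: translate_def)

text \<open>The order of quantifiers matters: \<open>x'\<close> depends on \<open>m\<close> alone.
  The factor 2 is the spacing of rows in \<open>lattice_pt\<close> coordinates.\<close>

lemma circles_from_append:
  "\<exists>x'. \<forall>n. circles_from x y (m @ n) = circles_from x y m @ circles_from x' (y + 2 * mheight m) n"
proof (induction m arbitrary: x y)
  case (Cons s m)
  show ?case
    using Cons.IH[of "x + 4" y] Cons.IH[of "x + 2" "y + 2"] Cons.IH[of "x + 2" "y - 2"]
    by (cases s) (simp_all add: mheight_def algebra_simps)
qed (auto simp: mheight_def)

text \<open>The ground row is \<open>y - 2 * h\<close>. An \<open>MD\<close> writes in the row it
  descends to, which is still at or above the ground.\<close>

lemma circles_from_row_ge: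
  "returns h m \<Longrightarrow> c \<in> set (circles_from x y m) \<Longrightarrow> sqrt 3 * of_int (y - 2 * h) \<le> Im c"
proof (induction m arbitrary: h x y)
  case (Cons s m)
  have h: "0 \<le> h" using Cons.prems(1) by simp
  show ?case
  proof (cases s)
    case MU
    then show ?thesis
      using Cons.prems h Cons.IH[of "h + 1" "x + 2" "y + 2"] by auto
  next
    case MF
    then show ?thesis
      using Cons.prems h Cons.IH[of h "x + 4" y] by auto
  next
    case MD
    then have "0 \<le> h - 1" using Cons.prems(1) returns_nonneg[of "h - 1" m] by simp
    then show ?thesis
      using Cons.prems MD Cons.IH[of "h - 1" "x + 2" "y - 2"] by auto
  qed
qed simp

lemma circles_from_Cons:
  "s \<noteq> MD \<Longrightarrow> \<exists>C. circles_from x y (s # m) = lattice_pt x y # C"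
  by (cases s) auto

text \<open>\<open>MD\<close> is recognized by its own circle, whereas \<open>MU\<close> and
  \<open>MF\<close> must be told apart by what follows. The equality of heights settles the case in
  which nothing follows.\<close>

lemma circles_from_inj:
  assumes "\<not> sublist [MU, MD] m" "\<not> sublist [MU, MD] m'" "mheight m = mheight m'"
    "circles_from x y m = circles_from x y m'"
  shows "m = m'"
  using assms
proof (induction m arbitrary: x y m')
  case (Cons s m)
  obtain s' n where m': "m' = s' # n" using Cons.prems(4) by (cases m') auto
  \<comment> \<open>Here \<open>k\<close> follows \<open>MF\<close> and \<open>k'\<close> follows
    \<open>MU\<close>. The next circle is \<open>lattice_pt (x + 2) (y + 2)\<close> after a rise,
    and elsewhere after a flat step.\<close>
  have not_flat_rise: "circles_from (x + 4) y k \<noteq> circles_from (x + 2) (y + 2) k'"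
    if "\<forall>r. k' \<noteq> MD # r" "mheight k = 1 + mheight k'" for k k'
  proof (cases k)
    case Nil
    then have "k' \<noteq> []" using that(2) by (auto simp: mheight_def)
    then show ?thesis using Nil by (metis circles_from.simps(1) circles_from_eq_Nil)
  next
    case (Cons t r)
    show ?thesis
    proof (cases k')
      case (Cons t' r')
      then have "t' \<noteq> MD" using that by auto
      then show ?thesis using Cons \<open>k = t # r\<close> circles_from_Cons[of t' "x + 2" "y + 2" r']
        by (cases t) auto
    qed (simp add: Cons)
  qed
  have "s = s'"
    using Cons.prems m' not_flat_rise[of n m] not_flat_rise[of m n]
    by (cases s; cases s') (auto simp: sublist_pair_Cons mheight_def)
  moreover have "m = n"
    using Cons.prems m' \<open>s = s'\<close> Cons.IH[of n]
    by (cases s) (auto simp: sublist_pair_Cons mheight_def)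
  ultimately show ?case using m' by simp
qed (metis circles_from.simps(1) circles_from_eq_Nil)

lemma peakless_motzkin_inj:
  assumes "m \<in> peakless_motzkin_paths" "m' \<in> peakless_motzkin_paths"
    "circles_from 2 0 m = circles_from 2 0 m'"
  shows "m = m'"
  using assms circles_from_inj[of m m'] by (auto simp: peakless_motzkin_paths_iff returns_mheight)

lemma peakless_motzkin_head:
  assumes "m \<in> peakless_motzkin_paths" "m \<noteq> []"
  shows "\<exists>C. circles_from x y m = lattice_pt x y # C"
proof -
  obtain s n where m: "m = s # n" using assms(2) by (cases m) auto
  have "s \<noteq> MD" using assms(1) m returns_nonneg[of "- 1" n] by (auto simp: peakless_motzkin_paths_iff)
  then show ?thesis unfolding m by (rule circles_from_Cons)
qed

text \<open>The height is measured from level \<open>k + 1\<close>, with \<open>j\<close> the excess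
  over it; the cut is the first \<open>MD\<close> read at excess 0.\<close>

lemma first_return:
  assumes "returns (k + 1 + j) m" "0 \<le> j" "0 \<le> k"
  shows "\<exists>a b. m = a @ MD # b \<and> returns j a \<and> returns k b"
  using assms
proof (induction m arbitrary: j)
  case (Cons s m)
  show ?case
  proof (cases "s = MD \<and> j = 0")
    case True
    then show ?thesis using Cons.prems by (intro exI[of _ "[]"] exI[of _ m]) simp
  next
    case False
    then have "0 \<le> j + mrise s" using Cons.prems by (cases s) auto
    moreover have "returns (k + 1 + (j + mrise s)) m" using Cons.prems by (simp add: add.assoc)
    ultimately obtain a b where "m = a @ MD # b" "returns (j + mrise s) a" "returns k b"
      using Cons.IH[of "j + mrise s"] Cons.prems by blast
    then show ?thesis using Cons.prems by (intro exI[of _ "s # a"] exI[of _ b]) simp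
  qed
qed simp

lemma peakless_motzkin_cases:
  assumes "m \<in> peakless_motzkin_paths"
  obtains "m = []"
  | a where "m = MF # a" "a \<in> peakless_motzkin_paths"
  | a b where "m = MU # a @ MD # b" "a \<in> peakless_motzkin_paths" "a \<noteq> []" "b \<in> peakless_motzkin_paths"
proof (cases m)
  case (Cons s n)
  have m: "returns 0 m" "\<not> sublist [MU, MD] m"
    using assms by (simp_all add: peakless_motzkin_paths_iff)
  show ?thesis
  proof (cases s)
    case MU
    have "returns (0 + 1 + 0) n" using m(1) Cons MU by simp
    then obtain a b where n: "n = a @ MD # b" "returns 0 a" "returns 0 b"
      using first_return[of 0 0 n] by auto
    have "m = [s] @ a @ MD # b" "m = (s # a @ [MD]) @ b @ []" using Cons n(1) by simp_all
    then have "sublist a m" "sublist b m" unfolding sublist_def by blast+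
    then have "\<not> sublist [MU, MD] a" "\<not> sublist [MU, MD] b"
      using m(2) sublist_order.order.trans by blast+
    moreover have "a \<noteq> []" using m(2) Cons MU n(1) by (auto simp: sublist_pair_Cons)
    ultimately show ?thesis
      using that(3)[of a b] n Cons MU by (simp add: peakless_motzkin_paths_iff)
  next
    case MF
    then show ?thesis
      using that(2)[of n] m Cons by (simp add: peakless_motzkin_paths_iff sublist_pair_Cons)
  next
    case MD
    then show ?thesis using m(1) Cons returns_nonneg[of "- 1" n] by simp
  qed
qed (use that(1) in simp)

lemma lattice_pt_horizontal: "lattice_pt a 0 = of_real (of_int a)"
  and lattice_pt_2_2: "lattice_pt 2 2 = Complex 2 (2 * sqrt 3)"
  by (simp_all add: complex_eq_iff)

lemma translate_eq_Nil [simp]: "translate v C = [] \<longleftrightarrow> C = []"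
  by (simp add: translate_def)

lemma translate_inj: "translate v C = translate v D \<Longrightarrow> C = D"
  unfolding translate_def by (rule map_injective) (auto intro: injI)

lemma circles_from_flat:
  "circles_from 2 0 (MF # a) = lattice_pt 2 0 # translate (of_real 4) (circles_from 2 0 a)"
  using circles_from_translate[of 2 4 0 0 a] by (simp add: lattice_pt_horizontal)

lemma circles_from_hill:
  assumes "returns 0 a"
  obtains x where "circles_from 2 0 (MU # a @ MD # b) =
    lattice_pt 2 0 # translate (Complex 2 (2 * sqrt 3)) (circles_from 2 0 a)
      @ lattice_pt x 0 # translate (of_real (of_int (x + 2))) (circles_from 2 0 b)"
proof -
  obtain x' where x': "circles_from 4 2 (a @ MD # b) = circles_from 4 2 a @ circles_from x' 2 (MD # b)"
    using circles_from_append[of 4 2 a] returns_mheight[OF assms] by auto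
  have "circles_from 4 2 a = translate (lattice_pt 2 2) (circles_from 2 0 a)"
    using circles_from_translate[of 2 2 0 2 a] by simp
  moreover have "circles_from (x' + 2) 0 b = translate (lattice_pt x' 0) (circles_from 2 0 b)"
    using circles_from_translate[of 2 x' 0 0 b] by (simp add: add.commute)
  \<comment> \<open>The closing \<open>MD\<close> is read at abscissa \<open>x'\<close> and writes
    its circle 2 to the left.\<close>
  ultimately show ?thesis
    using that[of "x' - 2"] x' by (simp add: lattice_pt_2_2 lattice_pt_horizontal)
qed

lemma hill_row_pos:
  assumes "returns 0 a" "c \<in> set (translate (Complex 2 (2 * sqrt 3)) (circles_from 2 0 a))"
  shows "Im c \<noteq> 0"
proof -
  have "c \<in> set (circles_from 4 2 a)"
    using circles_from_translate[of 2 2 0 2 a] assms(2) by (simp add: lattice_pt_2_2)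
  then have "sqrt 3 * 2 \<le> Im c" using circles_from_row_ge[OF assms(1)] by fastforce
  then show ?thesis using real_sqrt_gt_zero[of 3] by linarith
qed

section \<open>Existence and uniqueness of the value of \<open>g\<close>\<close>

lemma g_graph_circles_from:
  "m \<in> peakless_motzkin_paths \<Longrightarrow> g_graph (circles_from 2 0 m) m"
proof (induction m rule: length_induct)
  case (1 m)
  note IH = "1.IH"[rule_format]
  have seq: "circles_from 2 0 k \<in> inchworm_seqs" if "k \<in> peakless_motzkin_paths" for k
    using that by (simp add: inchworm_seqs_eq)
  from "1.prems" show ?case
  proof (cases rule: peakless_motzkin_cases)
    case 1
    then show ?thesis by (simp add: g_graph.empty)
  next
    case (2 a)
    show ?thesis unfolding 2(1)
    proof (rule g_graph.form_a)
      show "circles_from 2 0 (MF # a) \<in> inchworm_seqs" using seq[OF "1.prems"] 2(1) by simp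
      show "g_graph (circles_from 2 0 a) a" using IH 2 by simp
    qed (fact circles_from_flat, fact seq[OF 2(2)])
  next
    case (3 a b)
    have r: "returns 0 a" using 3 by (simp add: peakless_motzkin_paths_iff)
    obtain x where x: "circles_from 2 0 (MU # a @ MD # b) =
        lattice_pt 2 0 # translate (Complex 2 (2 * sqrt 3)) (circles_from 2 0 a)
          @ lattice_pt x 0 # translate (of_real (of_int (x + 2))) (circles_from 2 0 b)"
      using r by (rule circles_from_hill)
    show ?thesis unfolding 3(1)
    proof (rule g_graph.form_b[OF _ x])
      show "circles_from 2 0 (MU # a @ MD # b) \<in> inchworm_seqs" using seq[OF "1.prems"] 3(1) by simp
      show "g_graph (circles_from 2 0 a) a" "g_graph (circles_from 2 0 b) b" using IH 3 by simp_all
      show "\<forall>c\<in>set (translate (Complex 2 (2 * sqrt 3)) (circles_from 2 0 a)). Im c \<noteq> 0"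
        using hill_row_pos[OF r] by blast
    qed (use 3 seq in simp_all)
  qed
qed

text \<open>Nonempty sequences start at \<open>lattice_pt 2 0\<close>, so equal translates have
  equal offsets. For the empty word the offsets stay arbitrary, hence only the words are
  compared.\<close>

lemma translate_circles_from_cancel:
  assumes "m \<in> peakless_motzkin_paths" "m' \<in> peakless_motzkin_paths"
    "translate (of_real t) (circles_from 2 0 m) = translate (of_real t') (circles_from 2 0 m')"
  shows "m = m'"
proof (cases "m = []")
  case True
  then have "circles_from 2 0 m' = []" using assms(3) by (simp add: translate_def)
  then show ?thesis using True by simp
next
  case False
  then have "m' \<noteq> []" using assms(3) by (auto simp: translate_def)
  then have "t = t'"
    using assms(3) peakless_motzkin_head[OF assms(1) False, of 2 0]
      peakless_motzkin_head[OF assms(2), of 2 0]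
    by (auto simp: translate_def)
  then have "circles_from 2 0 m = circles_from 2 0 m'" using assms(3) translate_inj by blast
  then show ?thesis using assms peakless_motzkin_inj by blast
qed

text \<open>Applied with \<open>P\<close> saying that a circle is off the axis, this makes the cut
  in form (b) unambiguous.\<close>

lemma split_at_first:
  assumes "xs @ x # ys = xs' @ x' # ys'" "\<forall>z\<in>set xs. P z" "\<not> P x" "\<forall>z\<in>set xs'. P z" "\<not> P x'"
  shows "xs = xs' \<and> ys = ys'"
  using assms
proof (induction xs arbitrary: xs')
  case Nil
  then show ?case by (cases xs') auto
next
  case (Cons z xs)
  then show ?case by (cases xs') auto
qed

lemma circles_from_second_row:
  assumes "a \<in> peakless_motzkin_paths" "a \<noteq> []"
  shows "Im (hd (translate v (circles_from 2 0 a))) = Im v"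
  using peakless_motzkin_head[OF assms, of 2 0] by (auto simp: translate_def)

text \<open>A second circle has ordinate 0 in form (a) and \<open>2 * sqrt 3\<close> in form (b), so
  the forms exclude each other. Within a form the subsequences are determined by cancelling
  translations, even where \<open>t\<close> is not.\<close>

lemma g_graph_circles_from_unique:
  "g_graph C M \<Longrightarrow> m \<in> peakless_motzkin_paths \<Longrightarrow> C = circles_from 2 0 m \<Longrightarrow> M = m"
proof (induction arbitrary: m rule: g_graph.induct)
  case empty
  then show ?case by (metis circles_from_eq_Nil)
next
  case (form_a C c1 t A M)
  obtain a where a: "a \<in> peakless_motzkin_paths" "A = circles_from 2 0 a"
    using form_a.hyps by (auto simp: inchworm_seqs_eq)
  have "M = a" using form_a.IH a by simp
  have C: "circles_from 2 0 m = c1 # translate (of_real t) (circles_from 2 0 a)"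
    using form_a.hyps form_a.prems a by simp
  from form_a.prems(1) show ?case
  proof (cases rule: peakless_motzkin_cases)
    case 1
    then show ?thesis using C by simp
  next
    case (2 a')
    then have "a' = a"
      using C a circles_from_flat[of a'] translate_circles_from_cancel[of a' a 4 t] by simp
    then show ?thesis using 2 \<open>M = a\<close> by simp
  next
    case (3 a' b')
    have "returns 0 a'" using 3 by (simp add: peakless_motzkin_paths_iff)
    then obtain x where "circles_from 2 0 m =
        lattice_pt 2 0 # translate (Complex 2 (2 * sqrt 3)) (circles_from 2 0 a')
          @ lattice_pt x 0 # translate (of_real (of_int (x + 2))) (circles_from 2 0 b')"
      unfolding 3(1) by (rule circles_from_hill)
    then have e: "translate (of_real t) (circles_from 2 0 a) =
        translate (Complex 2 (2 * sqrt 3)) (circles_from 2 0 a')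
          @ lattice_pt x 0 # translate (of_real (of_int (x + 2))) (circles_from 2 0 b')"
      using C by simp
    then have "a \<noteq> []" by (auto simp: translate_def)
    then have "Im (hd (translate (of_real t) (circles_from 2 0 a))) = 0"
      using circles_from_second_row[OF a(1)] by simp
    moreover have "Im (hd (translate (Complex 2 (2 * sqrt 3)) (circles_from 2 0 a'))) = 2 * sqrt 3"
      using circles_from_second_row[OF 3(2,3)] by simp
    ultimately show ?thesis using 3(3) e by (simp add: hd_append)
  qed
next
  case (form_b C c1 A cj t B M N)
  obtain a where a: "a \<in> peakless_motzkin_paths" "A = circles_from 2 0 a"
    using form_b.hyps by (auto simp: inchworm_seqs_eq)
  obtain b where b: "b \<in> peakless_motzkin_paths" "B = circles_from 2 0 b"
    using form_b.hyps by (auto simp: inchworm_seqs_eq)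
  have "a \<noteq> []" using form_b.hyps a by auto
  have "M = a" "N = b" using form_b.IH a b by simp_all
  define v where "v = Complex 2 (2 * sqrt 3)"
  have C: "circles_from 2 0 m = c1 # translate v (circles_from 2 0 a)
      @ cj # translate (of_real t) (circles_from 2 0 b)"
    using form_b.hyps form_b.prems a b by (simp add: v_def)
  have h: "Im (hd (translate v (circles_from 2 0 a))) = 2 * sqrt 3"
    using circles_from_second_row[OF a(1) \<open>a \<noteq> []\<close>] by (simp add: v_def)
  from form_b.prems(1) show ?case
  proof (cases rule: peakless_motzkin_cases)
    case 1
    then show ?thesis using C by simp
  next
    case (2 a')
    then have e: "translate (of_real 4) (circles_from 2 0 a') = translate v (circles_from 2 0 a)
      @ cj # translate (of_real t) (circles_from 2 0 b)"
      using C circles_from_flat[of a'] by simp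
    then have "a' \<noteq> []" by (auto simp: translate_def)
    then have "Im (hd (translate (of_real 4) (circles_from 2 0 a'))) = 0"
      using circles_from_second_row[OF 2(2)] by simp
    then show ?thesis using h e \<open>a \<noteq> []\<close> by (simp add: hd_append)
  next
    case (3 a' b')
    have r: "returns 0 a'" using 3 by (simp add: peakless_motzkin_paths_iff)
    then obtain x where "circles_from 2 0 m =
        lattice_pt 2 0 # translate v (circles_from 2 0 a')
          @ lattice_pt x 0 # translate (of_real (of_int (x + 2))) (circles_from 2 0 b')"
      unfolding 3(1) v_def by (rule circles_from_hill)
    then have e: "translate v (circles_from 2 0 a) @ cj # translate (of_real t) (circles_from 2 0 b)
      = translate v (circles_from 2 0 a')
          @ lattice_pt x 0 # translate (of_real (of_int (x + 2))) (circles_from 2 0 b')"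
      using C by simp
    have "translate v (circles_from 2 0 a) = translate v (circles_from 2 0 a')
        \<and> translate (of_real t) (circles_from 2 0 b)
          = translate (of_real (of_int (x + 2))) (circles_from 2 0 b')"
      using form_b.hyps a hill_row_pos[OF r]
      by (intro split_at_first[OF e, of "\<lambda>c. Im c \<noteq> 0"]) (auto simp: v_def)
    then have "a = a'" "b = b'"
      using translate_inj peakless_motzkin_inj[OF a(1) 3(2)]
        translate_circles_from_cancel[OF b(1) 3(4)] by blast+
    then show ?thesis using 3 \<open>M = a\<close> \<open>N = b\<close> by simp
  qed
qed

lemma g_circle_seq_codes:
  assumes "codes w m"
  shows "g (circle_seq w) = m"
  unfolding g_def circle_seq_codes[OF assms]
  using g_graph_circles_from g_graph_circles_from_unique codes_peakless[OF assms] by blast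

theorem mainTheorem20:
  shows "(\<forall>C\<in>inchworm_seqs. \<exists>!M. g_graph C M)
    \<and> bij_betw (\<lambda>w. g (circle_seq w)) inchworm_paths peakless_motzkin_paths
    \<and> (\<forall>k. bij_betw (\<lambda>w. g (circle_seq w))
            {w \<in> inchworm_paths. kissing_number w = k}
            {m \<in> peakless_motzkin_paths. length m = k})"
proof (intro conjI allI ballI)
  fix C assume "C \<in> inchworm_seqs"
  then obtain m where "m \<in> peakless_motzkin_paths" "C = circles_from 2 0 m"
    by (auto simp: inchworm_seqs_eq)
  then show "\<exists>!M. g_graph C M"
    using g_graph_circles_from g_graph_circles_from_unique by blast
next
  have code: "codes w (g (circle_seq w))" if "w \<in> inchworm_paths" for w
    using that g_circle_seq_codes by (metis inchworm_paths_codes)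
  then have inj: "inj_on (\<lambda>w. g (circle_seq w)) inchworm_paths"
    by (metis (no_types, lifting) codes_injective inj_onI)
  have img: "(\<lambda>w. g (circle_seq w)) ` inchworm_paths = peakless_motzkin_paths"
  proof (intro equalityI subsetI)
    fix m assume "m \<in> peakless_motzkin_paths"
    then obtain w where w: "codes w m" by (rule peakless_codes)
    show "m \<in> (\<lambda>w. g (circle_seq w)) ` inchworm_paths"
      using g_circle_seq_codes[OF w] codes_inchworm_paths[OF w] by (intro image_eqI[of _ _ w]) simp_all
  qed (use code codes_peakless in blast)
  show "bij_betw (\<lambda>w. g (circle_seq w)) inchworm_paths peakless_motzkin_paths"
    using inj img by (simp add: bij_betw_def)
  have kiss: "kissing_number w = length (g (circle_seq w))" if "w \<in> inchworm_paths" for w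
    using kissing_number_codes[OF code[OF that]] .
  show "bij_betw (\<lambda>w. g (circle_seq w)) {w \<in> inchworm_paths. kissing_number w = k}
      {m \<in> peakless_motzkin_paths. length m = k}" for k
    unfolding bij_betw_def
  proof
    show "inj_on (\<lambda>w. g (circle_seq w)) {w \<in> inchworm_paths. kissing_number w = k}"
      using inj by (rule inj_on_subset) auto
    show "(\<lambda>w. g (circle_seq w)) ` {w \<in> inchworm_paths. kissing_number w = k} =
        {m \<in> peakless_motzkin_paths. length m = k}"
      \<comment> \<open>Kissing number and word length agree along the map, so fixing
        \<open>k\<close> selects matching subsets.\<close>
      unfolding img[symmetric] using kiss by auto
  qed
qed

end
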